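(* Let $U,V\subset\mathbb R^n$ be open bounded, let $c\in C^4(\overline U\times\overline V)$ satisfy (B1), let $u$ be a $c$-convex function on $\overline U$, and let $\lambda,\Lambda>0$. (a) If $|\partial^cu|\ge\lambda$ on $X\subset\overline U$ and $V$ is strongly $c^*$-convex with respect to $X$, then $(X\times\partial V)\cap\partial^cu\subset\partial X\times\partial V$; that is, interior points of $X$ are not mapped by $\partial^cu$ to boundary points of $V$. (b) If $|\partial^cu|\le\Lambda$ on $\overline U$ and $U$ is strongly $c$-convex with respect to $V$, then $\partial U\times V$ is disjoint from $\partial^cu$.
   Context: (B1): for all $\tilde x\in\overline U,\tilde y\in\overline V$ the maps $x\mapsto-D_yc(x,\tilde y)$ on $\overline U$ and $y\mapsto-D_xc(\tilde x,y)$ on $\overline V$ are diffeomorphisms onto their ranges. A convex set $W$ is strongly convex if there is $R<\infty$ such that for every $z\in\partial W$, $W\subset B_R(z-R\nu(z))$ where $\nu(z)$ is an outer unit normal to a supporting hyperplane of $W$ at $z$. $V$ is strongly $c^*$-convex with respect to $X$ if $-D_xc(\tilde x,V)$ is a strongly convex set for every $\tilde x\in X$; $U$ is strongly $c$-convex with respect to $V$ if $-D_yc(U,\tilde y)$ is strongly convex for every $\tilde y\in\overline V$. For $u:\overline U\to\mathbb R$: $u^{c^*}(y)=\sup_{x\in\overline U}(-c(x,y)-u(x))$, $v^c(x)=\sup_{y\in\overline V}(-c(x,y)-v(y))$, $u$ is $c$-convex if $u=(u^{c^*})^c$; $\partial^cu=\{(x,y)\in\overline U\times\overline V:u(x)+u^{c^*}(y)+c(x,y)=0\}$,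 $\partial^cu(X)=\{y:\exists x\in X,(x,y)\in\partial^cu\}$, $|\partial^cu|(X)=\mathcal L^n(\partial^cu(X))$; "$|\partial^cu|\ge\lambda$ on $W$" means $|\partial^cu|(E)\ge\lambda\mathcal L^n(E)$ for all Borel $E\subset W$, similarly for $\le$. *)

theory Defs
  imports "HOL-Analysis.Analysis"
begin

fun iter_dderiv :: "'a::real_normed_vector list \<Rightarrow> ('a \<Rightarrow> real) \<Rightarrow> 'a \<Rightarrow> real" where
  "iter_dderiv [] f = f"
| "iter_dderiv (v # vs) f = (\<lambda>x. frechet_derivative (iter_dderiv vs f) (at x) v)"

definition Ck_on :: "nat \<Rightarrow> 'a::real_normed_vector set \<Rightarrow> ('a \<Rightarrow> real) \<Rightarrow> bool" where
  "Ck_on k S f \<longleftrightarrow>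
     (\<forall>vs. length vs < k \<longrightarrow> (\<forall>x\<in>S. iter_dderiv vs f differentiable (at x))) \<and>
     (\<forall>vs. length vs \<le> k \<longrightarrow> continuous_on S (iter_dderiv vs f))"

definition Ck_on_set :: "nat \<Rightarrow> 'a::real_normed_vector set \<Rightarrow> ('a \<Rightarrow> real) \<Rightarrow> bool" where
  "Ck_on_set k K f \<longleftrightarrow> (\<exists>N. open N \<and> K \<subseteq> N \<and> Ck_on k N f)"

definition grad :: "('a::euclidean_space \<Rightarrow> real) \<Rightarrow> 'a \<Rightarrow> 'a" where
  "grad f x = (\<Sum>b\<in>Basis. frechet_derivative f (at x) b *\<^sub>R b)"

definition Dx :: "('a::euclidean_space \<Rightarrow> 'a \<Rightarrow> real) \<Rightarrow> 'a \<Rightarrow> 'a \<Rightarrow> 'a" where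
  "Dx c x y = grad (\<lambda>x'. c x' y) x"

definition Dy :: "('a::euclidean_space \<Rightarrow> 'a \<Rightarrow> real) \<Rightarrow> 'a \<Rightarrow> 'a \<Rightarrow> 'a" where
  "Dy c x y = grad (\<lambda>y'. c x y') y"

definition diffeo_onto_range :: "('a::euclidean_space \<Rightarrow> 'a) \<Rightarrow> 'a set \<Rightarrow> bool" where
  "diffeo_onto_range f S \<longleftrightarrow> inj_on f S \<and>
     (\<forall>x\<in>S. \<exists>f' g'. (f has_derivative f') (at x) \<and>
        (inv_into S f has_derivative g') (at (f x) within f ` S) \<and>
        g' \<circ> f' = id \<and> f' \<circ> g' = id)"

definition B1 :: "('a::euclidean_space \<Rightarrow> 'a \<Rightarrow> real) \<Rightarrow> 'a set \<Rightarrow> 'a set \<Rightarrow> bool" where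
  "B1 c U V \<longleftrightarrow>
     (\<forall>x0\<in>closure U. \<forall>y0\<in>closure V.
        diffeo_onto_range (\<lambda>x. - Dy c x y0) (closure U) \<and>
        diffeo_onto_range (\<lambda>y. - Dx c x0 y) (closure V))"

definition strongly_convex :: "'a::euclidean_space set \<Rightarrow> bool" where
  "strongly_convex W \<longleftrightarrow> convex W \<and>
     (\<exists>R::real. \<forall>z\<in>frontier W. \<forall>\<nu>. (norm \<nu> = 1 \<and> (\<forall>w\<in>W. inner (w - z) \<nu> \<le> 0))
         \<longrightarrow> W \<subseteq> cball (z - R *\<^sub>R \<nu>) R)"

definition strongly_cstar_convex ::
  "('a::euclidean_space \<Rightarrow> 'a \<Rightarrow> real) \<Rightarrow> 'a set \<Rightarrow> 'a set \<Rightarrow> bool" where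
  "strongly_cstar_convex c V X \<longleftrightarrow> (\<forall>x0\<in>X. strongly_convex ((\<lambda>y. - Dx c x0 y) ` V))"

definition strongly_c_convex ::
  "('a::euclidean_space \<Rightarrow> 'a \<Rightarrow> real) \<Rightarrow> 'a set \<Rightarrow> 'a set \<Rightarrow> bool" where
  "strongly_c_convex c U V \<longleftrightarrow> (\<forall>y0\<in>closure V. strongly_convex ((\<lambda>x. - Dy c x y0) ` U))"

definition c_star_transform ::
  "('a::topological_space \<Rightarrow> 'a \<Rightarrow> real) \<Rightarrow> 'a set \<Rightarrow> ('a \<Rightarrow> real) \<Rightarrow> 'a \<Rightarrow> real" where
  "c_star_transform c U u y = (SUP x\<in>closure U. - c x y - u x)"

definition c_transform ::
  "('a::topological_space \<Rightarrow> 'a \<Rightarrow> real) \<Rightarrow> 'a set \<Rightarrow> ('a \<Rightarrow> real) \<Rightarrow> 'a \<Rightarrow> real" where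
  "c_transform c V v x = (SUP y\<in>closure V. - c x y - v y)"

definition c_convex ::
  "('a::metric_space \<Rightarrow> 'a \<Rightarrow> real) \<Rightarrow> 'a set \<Rightarrow> 'a set \<Rightarrow> ('a \<Rightarrow> real) \<Rightarrow> bool" where
  "c_convex c U V u \<longleftrightarrow>
     (\<forall>y\<in>closure V. bdd_above ((\<lambda>x. - c x y - u x) ` closure U)) \<and>
     (\<forall>x\<in>closure U. bdd_above ((\<lambda>y. - c x y - c_star_transform c U u y) ` closure V) \<and>
        u x = c_transform c V (c_star_transform c U u) x)"

definition c_subdiff ::
  "('a::metric_space \<Rightarrow> 'a \<Rightarrow> real) \<Rightarrow> 'a set \<Rightarrow> 'a set \<Rightarrow> ('a \<Rightarrow> real) \<Rightarrow> ('a \<times> 'a) set" where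
  "c_subdiff c U V u = {(x, y). x \<in> closure U \<and> y \<in> closure V \<and>
      u x + c_star_transform c U u y + c x y = 0}"

definition c_subdiff_image ::
  "('a::metric_space \<Rightarrow> 'a \<Rightarrow> real) \<Rightarrow> 'a set \<Rightarrow> 'a set \<Rightarrow> ('a \<Rightarrow> real) \<Rightarrow> 'a set \<Rightarrow> 'a set" where
  "c_subdiff_image c U V u X = {y. \<exists>x\<in>X. (x, y) \<in> c_subdiff c U V u}"

definition csub_ge :: "('a::euclidean_space \<Rightarrow> 'a \<Rightarrow> real) \<Rightarrow> 'a set \<Rightarrow> 'a set \<Rightarrow> ('a \<Rightarrow> real)
    \<Rightarrow> real \<Rightarrow> 'a set \<Rightarrow> bool" where
  "csub_ge c U V u l W \<longleftrightarrow> (\<forall>E. E \<in> sets borel \<longrightarrow> E \<subseteq> W \<longrightarrow>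
      measure lebesgue (c_subdiff_image c U V u E) \<ge> l * measure lebesgue E)"

definition csub_le :: "('a::euclidean_space \<Rightarrow> 'a \<Rightarrow> real) \<Rightarrow> 'a set \<Rightarrow> 'a set \<Rightarrow> ('a \<Rightarrow> real)
    \<Rightarrow> real \<Rightarrow> 'a set \<Rightarrow> bool" where
  "csub_le c U V u L W \<longleftrightarrow> (\<forall>E. E \<in> sets borel \<longrightarrow> E \<subseteq> W \<longrightarrow>
      measure lebesgue (c_subdiff_image c U V u E) \<le> L * measure lebesgue E)"

end

theory Submission
  imports Defs
begin

text \<open>
  Fix \<open>(x0, y0)\<close> in the \<open>c\<close>-subdifferential with \<open>y0 \<in> \<partial>V\<close>, put \<open>P y = - D\<^sub>xc(x0, y)\<close>,
  \<open>Q x = - D\<^sub>yc(x, y0)\<close>, \<open>M = DP(y0)\<close>, and let \<open>\<nu>\<close> be an outer normal of \<open>P(V)\<close> at \<open>P y0\<close>. By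
  \<open>c\<close>-monotonicity the mixed difference \<open>f(x, y) = c(x0, y) + c(x, y0) - c(x, y) - c(x0, y0)\<close> is
  nonnegative on the subdifferential. If \<open>Q x - Q x0\<close> lies in the cone of aperture \<open>\<theta>\<close> about
  \<open>w = M\<^sup>T\<nu>\<close>, a mixed third-order expansion turns \<open>f(x, y) \<ge> 0\<close> into
  \<open>- (P y - P y0) \<bullet> \<nu> \<le> \<theta>|y - y0| + \<epsilon>|y - y0|\<^sup>2\<close>, whereas strong convexity bounds the left-hand side
  from below by a multiple of \<open>|y - y0|\<^sup>2\<close>. Hence \<open>y\<close> lies in a slab of radius \<open>O(\<theta>)\<close> and thickness
  \<open>O(\<theta>\<^sup>2)\<close>, of measure \<open>O(\<theta>^(n+1))\<close>, while the cone reaches out to a distance independent of \<open>\<theta>\<close>,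
  so that its measure is at least of order \<open>\<theta>^(n-1)\<close>; \<open>\<theta> \<rightarrow> 0\<close> contradicts the bounds on the measure of the image. Part (b) is
  the same estimate with the two variables exchanged.
\<close>

section \<open>Iterated directional derivatives\<close>

text \<open>The cone is cut out in the coordinate \<open>Q x\<close> and not in \<open>x\<close>,
  because \<open>Q\<close> carries exactly the part of \<open>f\<close> that is linear in y - y0.
  The remainder then has no term of order |x - x0|^2 |y - y0|. Such a term would force |x - x0| to
  be of order \<theta>, and so short a cone has measure of order \<theta>^(2n-1), which does not
  beat \<theta>^(n+1) once n > 1. With the curved cone the ratio of the two measures is of order
  \<theta>^2. The nonlinear part of \<open>P\<close> is kept exactly as well: a remainder |x - x0|
  |y - y0|^2 with a bounded instead of a small factor would compete with the quadratic term that
  strong convexity provides. The expansion is local in \<open>y\<close>, whereas image points may a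
  priori lie anywhere in the closure of the target. Far from \<open>y0\<close> they are excluded by
  a first order expansion in \<open>x\<close> alone, uniform over that compact set, together with
  the injectivity of \<open>P\<close>.\<close>

definition dird :: "'a::real_normed_vector \<Rightarrow> ('a \<Rightarrow> real) \<Rightarrow> 'a \<Rightarrow> real" where
  "dird v f x = frechet_derivative f (at x) v"

lemma iter_dderiv_append: "iter_dderiv (vs @ ws) f = iter_dderiv vs (iter_dderiv ws f)"
  by (induction vs) auto

lemma iter_dderiv_dird: "iter_dderiv vs (dird v f) = iter_dderiv (vs @ [v]) f"
  by (simp add: iter_dderiv_append dird_def[abs_def])

lemma Ck_on_0: "Ck_on 0 S f \<longleftrightarrow> continuous_on S f"
  by (auto simp: Ck_on_def)

text \<open>The head of a list is the outermost derivative, so passing from \<open>f\<close> to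
  \<open>dird v f\<close> removes the last entry; lists are therefore split from the right. This
  gives the recursion on \<open>k\<close> behind the inductions on smoothness below.\<close>

lemma Ck_on_Suc:
  "Ck_on (Suc k) S f \<longleftrightarrow>
     continuous_on S f \<and> (\<forall>x\<in>S. f differentiable (at x)) \<and> (\<forall>v. Ck_on k S (dird v f))"
proof -
  have split: "(\<forall>vs::'a list. length vs < Suc n \<longrightarrow> Q vs) \<longleftrightarrow>
      Q [] \<and> (\<forall>v vs. length vs < n \<longrightarrow> Q (vs @ [v]))" for n Q
  proof (intro iffI conjI allI impI)
    fix vs :: "'a list"
    assume "Q [] \<and> (\<forall>v vs. length vs < n \<longrightarrow> Q (vs @ [v]))" "length vs < Suc n"
    then show "Q vs" by (cases vs rule: rev_cases) auto
  qed auto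
  show ?thesis
    using split[of k "\<lambda>vs. \<forall>x\<in>S. iter_dderiv vs f differentiable (at x)"]
      split[of "Suc k" "\<lambda>vs. continuous_on S (iter_dderiv vs f)"]
    unfolding Ck_on_def iter_dderiv_dird by (auto simp: less_Suc_eq_le)
qed

lemma Ck_on_SucD:
  assumes "Ck_on (Suc k) S f"
  shows "continuous_on S f" "\<And>x. x \<in> S \<Longrightarrow> f differentiable (at x)" "Ck_on k S (dird v f)"
  using assms by (auto simp: Ck_on_Suc)

lemma Ck_on_1D:
  assumes "Ck_on 1 S f"
  shows "continuous_on S f" "\<And>x. x \<in> S \<Longrightarrow> f differentiable (at x)" "continuous_on S (dird v f)"
  using assms Ck_on_SucD[of 0 S f] by (simp_all add: Ck_on_0)

lemma Ck_on_2D: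
  assumes "Ck_on 2 S f"
  shows "continuous_on S f" "\<And>x. x \<in> S \<Longrightarrow> f differentiable (at x)" "Ck_on 1 S (dird v f)"
  using assms Ck_on_SucD[of 1 S f] by (simp_all add: numeral_2_eq_2)

lemma Ck_on_3D:
  assumes "Ck_on 3 S f"
  shows "continuous_on S f" "\<And>x. x \<in> S \<Longrightarrow> f differentiable (at x)" "Ck_on 2 S (dird v f)"
  using assms Ck_on_SucD[of 2 S f] by (simp_all add: numeral_3_eq_3 numeral_2_eq_2)

lemma Ck_on_le: "Ck_on n S f \<Longrightarrow> m \<le> n \<Longrightarrow> Ck_on m S f"
  unfolding Ck_on_def by (meson order.trans order.strict_trans2)

lemma Ck_on_cong:
  assumes "Ck_on k S f" "open S" "\<And>x. x \<in> S \<Longrightarrow> f x = g x"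
  shows "Ck_on k S g"
  using assms
proof (induction k arbitrary: f g)
  case 0
  then show ?case by (simp add: Ck_on_0 cong: continuous_on_cong)
next
  case (Suc k)
  have diff: "g differentiable (at x)" if "x \<in> S" for x
    using Suc.prems that unfolding Ck_on_Suc
    by (meson differentiable_def has_derivative_transform_within_open)
  have "dird v f x = dird v g x" if "x \<in> S" for x v
    unfolding dird_def using Suc.prems that Ck_on_SucD(2)
    by (metis frechet_derivative_transform_within_open)
  then have "Ck_on k S (dird v g)" for v
    using Suc.IH[of "dird v f" "dird v g"] Suc.prems by (auto simp: Ck_on_Suc)
  moreover have "continuous_on S g"
    using Suc.prems by (simp add: Ck_on_Suc cong: continuous_on_cong)
  ultimately show ?case using diff by (simp add: Ck_on_Suc)
qed

lemma has_derivative_dird: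
  assumes "f differentiable (at x)"
  shows "(f has_derivative (\<lambda>v. dird v f x)) (at x)"
  using assms frechet_derivative_works unfolding dird_def by blast

lemma dird_eqI: "(f has_derivative f') (at x) \<Longrightarrow> dird v f x = f' v"
  unfolding dird_def by (metis frechet_derivative_at)

lemma linear_dird: "f differentiable (at x) \<Longrightarrow> linear (\<lambda>v. dird v f x)"
  using has_derivative_dird has_derivative_linear by blast

text \<open>By the chain rule the derivative of \<open>f \<circ> prod.swap\<close> along
  \<open>v\<close> is \<open>dird (prod.swap v) f \<circ> prod.swap\<close>, but this is known on
  the open set only, which is why \<open>Ck_on_cong\<close> enters the induction. It serves (b),
  where the variables of the cost are exchanged.\<close>

lemma Ck_on_swap:
  fixes f :: "'a::euclidean_space \<times> 'a \<Rightarrow> real"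
  assumes "Ck_on k S f" "open S"
  shows "Ck_on k (prod.swap ` S) (f \<circ> prod.swap)"
  using assms
proof (induction k arbitrary: f)
  case 0
  then show ?case
    unfolding Ck_on_0 by (intro continuous_on_compose continuous_on_swap) (simp add: image_image)
next
  case (Suc k)
  let ?T = "prod.swap ` S"
  have T: "open ?T"
  proof -
    have "?T = prod.swap -` S" by (auto intro: image_eqI[of _ _ "prod.swap _"])
    then show ?thesis using Suc.prems by (simp add: open_vimage continuous_on_swap)
  qed
  have swap': "(prod.swap has_derivative prod.swap) (at z)" for z :: "'a \<times> 'a"
    unfolding prod.swap_def[abs_def] by (auto intro!: derivative_eq_intros)
  have der: "(f \<circ> prod.swap has_derivative (\<lambda>v. dird (prod.swap v) f (prod.swap z))) (at z)"
    if "z \<in> ?T" for z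
  proof -
    have "f differentiable (at (prod.swap z))" using that Suc.prems by (auto simp: Ck_on_Suc)
    from diff_chain_at[OF swap' has_derivative_dird[OF this]] show ?thesis by (simp add: o_def)
  qed
  have "Ck_on k ?T (dird v (f \<circ> prod.swap))" for v
  proof (rule Ck_on_cong[OF _ T])
    show "Ck_on k ?T (dird (prod.swap v) f \<circ> prod.swap)"
      using Suc.prems(2) by (intro Suc.IH Ck_on_SucD(3)[OF Suc.prems(1)])
    show "(dird (prod.swap v) f \<circ> prod.swap) z = dird v (f \<circ> prod.swap) z" if "z \<in> ?T" for z
      using dird_eqI[OF der[OF that]] by simp
  qed
  moreover have "\<forall>z\<in>?T. f \<circ> prod.swap differentiable (at z)"
    using der unfolding differentiable_def by blast
  moreover have "continuous_on ?T (f \<circ> prod.swap)"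
    using Suc.prems unfolding Ck_on_Suc
    by (intro continuous_on_compose continuous_on_swap) (simp add: image_image)
  ultimately show ?case unfolding Ck_on_Suc by blast
qed

lemma mvt_dird:
  assumes "\<And>t. 0 \<le> t \<Longrightarrow> t \<le> 1 \<Longrightarrow> f differentiable (at (a + t *\<^sub>R v))"
  shows "\<exists>t. 0 < t \<and> t < 1 \<and> f (a + v) - f a = dird v f (a + t *\<^sub>R v)"
proof -
  have der: "((\<lambda>t. f (a + t *\<^sub>R v)) has_derivative (\<lambda>h. h * dird v f (a + t *\<^sub>R v))) (at t within {0..1})"
    if "t \<in> {0..1}" for t :: real
  proof -
    have aff: "((\<lambda>t. a + t *\<^sub>R v) has_derivative (\<lambda>h. h *\<^sub>R v)) (at t within {0..1})"
      by (auto intro!: derivative_eq_intros)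
    have d: "f differentiable (at (a + t *\<^sub>R v))" using that assms by auto
    have "((\<lambda>t. f (a + t *\<^sub>R v)) has_derivative (\<lambda>h. dird (h *\<^sub>R v) f (a + t *\<^sub>R v))) (at t within {0..1})"
      using has_derivative_compose[of "\<lambda>t. a + t *\<^sub>R v" _ t _ f, OF aff has_derivative_dird[OF d]] .
    then show ?thesis using linear_scale[OF linear_dird[OF d]] by simp
  qed
  from mvt_simple[of 0 1 "\<lambda>t. f (a + t *\<^sub>R v)" "\<lambda>t h. h * dird v f (a + t *\<^sub>R v)"] der
  show ?thesis by auto
qed

lemma mvt_dird_convex:
  assumes "\<And>z. z \<in> C \<Longrightarrow> f differentiable (at z)" "convex C" "a \<in> C" "b \<in> C"
  shows "\<exists>z\<in>C. f b - f a = dird (b - a) f z"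
proof -
  have C: "a + t *\<^sub>R (b - a) \<in> C" if "0 \<le> t" "t \<le> 1" for t
    using convexD[OF assms(2,3,4), of "1 - t" t] that by (simp add: algebra_simps)
  then show ?thesis
    using mvt_dird[of f a "b - a"] assms(1) by auto
qed

text \<open>The second difference over the parallelogram with sides \<open>t *\<^sub>R v\<close> and
  \<open>t *\<^sub>R w\<close> is symmetric in the two sides. Two mean value theorems write it as
  t^2 times either mixed derivative at some nearby point, and continuity of both at \<open>z\<close>
  forces equality.\<close>

lemma dird_symmetric:
  fixes f :: "'a::real_normed_vector \<Rightarrow> real"
  assumes S: "open S" "z \<in> S" and f: "Ck_on 2 S f"
  shows "dird v (dird w f) z = dird w (dird v f) z"
proof (rule ccontr)
  assume ne: "dird v (dird w f) z \<noteq> dird w (dird v f) z"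
  define e where "e = \<bar>dird v (dird w f) z - dird w (dird v f) z\<bar> / 2"
  have e: "e > 0" using ne by (simp add: e_def)
  have f2: "f differentiable (at x)" "dird v f differentiable (at x)"
    "continuous_on S (dird v (dird w f))" if "x \<in> S" for x v w
    using f that by (auto simp: eval_nat_numeral Ck_on_Suc Ck_on_0)
  have near: "\<exists>r>0. ball z r \<subseteq> S \<and> (\<forall>x\<in>ball z r. \<bar>dird v (dird w f) x - dird v (dird w f) z\<bar> < e)" for v w
  proof -
    have "isCont (dird v (dird w f)) z"
      using f2(3) S continuous_on_eq_continuous_at by blast
    then obtain r where r: "r > 0" "\<And>x. dist x z < r \<Longrightarrow> dist (dird v (dird w f) x) (dird v (dird w f) z) < e"
      using e unfolding continuous_at_eps_delta by blast
    obtain r' where r': "r' > 0" "ball z r' \<subseteq> S" using S open_contains_ball by blast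
    show ?thesis
      using r r' by (intro exI[of _ "min r r'"]) (auto simp: dist_commute dist_real_def)
  qed
  obtain r1 where r1: "r1 > 0" "ball z r1 \<subseteq> S"
    "\<And>x. x \<in> ball z r1 \<Longrightarrow> \<bar>dird v (dird w f) x - dird v (dird w f) z\<bar> < e" using near by meson
  obtain r2 where r2: "r2 > 0" "ball z r2 \<subseteq> S"
    "\<And>x. x \<in> ball z r2 \<Longrightarrow> \<bar>dird w (dird v f) x - dird w (dird v f) z\<bar> < e" using near by meson
  \<comment> \<open>The parallelogram stays within t (|v| + |w|) < min r1 r2 of \<open>z\<close>;
    the summand 1 keeps the denominator positive without a case distinction on the
    directions.\<close>
  define t where "t = min r1 r2 / (2 * (norm v + norm w + 1))"
  have t: "t > 0" using r1 r2 unfolding t_def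
    by (intro divide_pos_pos) (auto intro: add_nonneg_pos)
  have inball: "z + (a * t) *\<^sub>R v + (b * t) *\<^sub>R w \<in> ball z r1 \<inter> ball z r2"
    if "0 \<le> a" "a \<le> 1" "0 \<le> b" "b \<le> 1" for a b
  proof -
    have "norm ((a * t) *\<^sub>R v + (b * t) *\<^sub>R w) \<le> norm ((a * t) *\<^sub>R v) + norm ((b * t) *\<^sub>R w)"
      by (rule norm_triangle_ineq)
    also have "\<dots> \<le> t * norm v + t * norm w"
      using that t by (simp add: abs_mult mult_right_mono mult_left_le_one_le add_mono)
    also have "\<dots> < t * (2 * (norm v + norm w + 1))"
      using t by (simp add: algebra_simps) (smt (verit) mult_nonneg_nonneg norm_ge_zero)
    also have "\<dots> = min r1 r2"
      unfolding t_def using norm_ge_zero[of v] norm_ge_zero[of w] by (simp add: add_nonneg_eq_0_iff)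
    finally show ?thesis by (simp add: dist_norm norm_minus_commute add.assoc)
      (metis add.commute add_diff_cancel_left' diff_add_cancel norm_minus_commute minus_add_distrib)
  qed
  have lin: "dird (t *\<^sub>R v) f x = t * dird v f x" if "f differentiable (at x)" for f v x
    using linear_scale[OF linear_dird[OF that]] by simp
  \<comment> \<open>\<open>v\<close> and \<open>w\<close> are rebound here: the claim is used once
    for each order of the two directions, with the same two balls.\<close>
  have quad: "\<exists>x\<in>ball z r1 \<inter> ball z r2. f (z + t *\<^sub>R v + t *\<^sub>R w) - f (z + t *\<^sub>R v) - f (z + t *\<^sub>R w) + f z
      = t * (t * dird w (dird v f) x)"
    if "\<And>a b. \<lbrakk>0 \<le> a; a \<le> 1; 0 \<le> b; b \<le> 1\<rbrakk> \<Longrightarrow> z + (a * t) *\<^sub>R v + (b * t) *\<^sub>R w \<in> ball z r1 \<inter> ball z r2" for v w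
  proof -
    have inS: "z + (a * t) *\<^sub>R v + (b * t) *\<^sub>R w \<in> S" if "0 \<le> a" "a \<le> 1" "0 \<le> b" "b \<le> 1" for a b
      using \<open>\<And>a b. \<lbrakk>0 \<le> a; a \<le> 1; 0 \<le> b; b \<le> 1\<rbrakk> \<Longrightarrow> z + (a * t) *\<^sub>R v + (b * t) *\<^sub>R w \<in> ball z r1 \<inter> ball z r2\<close>[OF that] r1 by auto
    define g where "g x = f (x + t *\<^sub>R w) - f x" for x
    have dg: "(g has_derivative (\<lambda>u. dird u f (z + (a * t) *\<^sub>R v + t *\<^sub>R w) - dird u f (z + (a * t) *\<^sub>R v))) (at (z + a *\<^sub>R (t *\<^sub>R v)))"
      if a: "0 \<le> a" "a \<le> 1" for a
    proof -
      let ?x = "z + (a * t) *\<^sub>R v"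
      have 1: "f differentiable (at (?x + t *\<^sub>R w))" "f differentiable (at ?x)"
        using inS[OF a, of 1] inS[OF a, of 0] f2 by auto
      have "((\<lambda>x. x + t *\<^sub>R w) has_derivative (\<lambda>h. h)) (at ?x)" by (auto intro!: derivative_eq_intros)
      from has_derivative_compose[OF this has_derivative_dird[OF 1(1)]] has_derivative_dird[OF 1(2)]
      show ?thesis unfolding g_def[abs_def] by (auto intro!: derivative_eq_intros)
    qed
    obtain a where a: "0 < a" "a < 1" "g (z + t *\<^sub>R v) - g z = dird (t *\<^sub>R v) g (z + a *\<^sub>R (t *\<^sub>R v))"
      using mvt_dird[of g z "t *\<^sub>R v"] dg unfolding differentiable_def by blast
    let ?x = "z + (a * t) *\<^sub>R v"
    have 1: "f differentiable (at (?x + t *\<^sub>R w))" "f differentiable (at ?x)"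
      using inS[of a 1] inS[of a 0] a f2 by auto
    have "g (z + t *\<^sub>R v) - g z = t * (dird v f (?x + t *\<^sub>R w) - dird v f ?x)"
      using a(3) dird_eqI[OF dg[of a], of "t *\<^sub>R v"] a(1,2) lin[OF 1(1)] lin[OF 1(2)]
      by (simp add: right_diff_distrib)
    moreover obtain b where b: "0 < b" "b < 1" "dird v f (?x + t *\<^sub>R w) - dird v f ?x = dird (t *\<^sub>R w) (dird v f) (?x + b *\<^sub>R (t *\<^sub>R w))"
      using mvt_dird[of "dird v f" ?x "t *\<^sub>R w"] inS[of a] a f2 by auto
    moreover have "dird (t *\<^sub>R w) (dird v f) (?x + b *\<^sub>R (t *\<^sub>R w)) = t * dird w (dird v f) (?x + b *\<^sub>R (t *\<^sub>R w))"
      using inS[of a b] a(1,2) b(1,2) by (intro lin f2(2)) auto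
    ultimately have "g (z + t *\<^sub>R v) - g z = t * (t * dird w (dird v f) (?x + (b * t) *\<^sub>R w))" by simp
    then have "f (z + t *\<^sub>R v + t *\<^sub>R w) - f (z + t *\<^sub>R v) - f (z + t *\<^sub>R w) + f z
        = t * (t * dird w (dird v f) (?x + (b * t) *\<^sub>R w))"
      unfolding g_def by simp
    moreover have "?x + (b * t) *\<^sub>R w \<in> ball z r1 \<inter> ball z r2"
      using a b by (intro that) auto
    ultimately show ?thesis by blast
  qed
  obtain x where x: "x \<in> ball z r1 \<inter> ball z r2"
    "f (z + t *\<^sub>R v + t *\<^sub>R w) - f (z + t *\<^sub>R v) - f (z + t *\<^sub>R w) + f z = t * (t * dird w (dird v f) x)"
    using quad[of v w] inball by blast
  obtain x' where x': "x' \<in> ball z r1 \<inter> ball z r2"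
    "f (z + t *\<^sub>R w + t *\<^sub>R v) - f (z + t *\<^sub>R w) - f (z + t *\<^sub>R v) + f z = t * (t * dird v (dird w f) x')"
  proof -
    have "z + (a * t) *\<^sub>R w + (b * t) *\<^sub>R v \<in> ball z r1 \<inter> ball z r2"
      if "0 \<le> a" "a \<le> 1" "0 \<le> b" "b \<le> 1" for a b
      using inball[of b a] that by (simp add: add.assoc add.commute[of "(a * t) *\<^sub>R w"])
    from quad[of w v, OF this] show ?thesis using that by blast
  qed
  have "t * (t * dird w (dird v f) x) = t * (t * dird v (dird w f) x')"
    using x(2) x'(2) by (simp add: algebra_simps)
  then have "dird w (dird v f) x = dird v (dird w f) x'" using t by simp
  then show False using r1(3)[of x'] r2(3)[of x] x(1) x'(1) unfolding e_def by auto argo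
qed

section \<open>Mixed expansions of functions on a product\<close>

lemma linear_bound_Basis:
  fixes A :: "'a::euclidean_space \<Rightarrow> real"
  assumes "linear A" "\<And>i. i \<in> Basis \<Longrightarrow> \<bar>A i\<bar> \<le> C i"
  shows "\<bar>A v\<bar> \<le> (\<Sum>i\<in>Basis. C i) * norm v"
proof -
  have "A v = A (\<Sum>i\<in>Basis. (v \<bullet> i) *\<^sub>R i)" by (simp add: euclidean_representation)
  also have "\<dots> = (\<Sum>i\<in>Basis. (v \<bullet> i) * A i)"
    using assms(1) by (simp add: linear_sum linear_scale)
  finally have "\<bar>A v\<bar> \<le> (\<Sum>i\<in>Basis. \<bar>(v \<bullet> i) * A i\<bar>)" by simp
  also have "\<dots> \<le> (\<Sum>i\<in>Basis. norm v * C i)"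
    using assms(2) by (intro sum_mono) (simp add: abs_mult mult_mono Basis_le_norm)
  finally show ?thesis by (simp add: sum_distrib_left sum_distrib_right mult.commute)
qed

text \<open>Continuity arguments give a radius that depends on the direction. Only finitely many
  basis directions have to be intersected, and linearity then yields one radius that serves every
  \<open>v\<close>.\<close>

lemma eventually_linear_bound_Basis:
  fixes A :: "'v::euclidean_space \<Rightarrow> 'p \<Rightarrow> real"
  assumes "\<And>i. i \<in> Basis \<Longrightarrow> \<forall>\<^sub>F r in F. \<forall>p\<in>S r. \<bar>A i p\<bar> \<le> C i * k p"
    and "\<forall>\<^sub>F r in F. \<forall>p\<in>S r. linear (\<lambda>v. A v p)"
  shows "\<forall>\<^sub>F r in F. \<forall>p\<in>S r. \<forall>v. \<bar>A v p\<bar> \<le> (\<Sum>i\<in>Basis. C i) * norm v * k p"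
proof -
  have "\<forall>\<^sub>F r in F. \<forall>i\<in>Basis. \<forall>p\<in>S r. \<bar>A i p\<bar> \<le> C i * k p"
    using assms(1) by (intro eventually_ball_finite) auto
  with assms(2) show ?thesis
  proof eventually_elim
    case (elim r)
    show ?case
    proof (intro ballI allI)
      fix p v assume p: "p \<in> S r"
      have "\<bar>A v p\<bar> \<le> (\<Sum>i\<in>Basis. C i * k p) * norm v"
        using elim p by (intro linear_bound_Basis) auto
      then show "\<bar>A v p\<bar> \<le> (\<Sum>i\<in>Basis. C i) * norm v * k p"
        by (simp add: mult_ac flip: sum_distrib_right)
    qed
  qed
qed

lemma exists_linear_bound_Basis:
  fixes A :: "'v::euclidean_space \<Rightarrow> 'p \<Rightarrow> real"
  assumes "\<And>i. \<exists>C\<ge>0. \<forall>\<^sub>F r in F. \<forall>p\<in>S r. \<bar>A i p\<bar> \<le> C * k p"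
    and "\<forall>\<^sub>F r in F. \<forall>p\<in>S r. linear (\<lambda>v. A v p)"
  shows "\<exists>C\<ge>0. \<forall>\<^sub>F r in F. \<forall>p\<in>S r. \<forall>v. \<bar>A v p\<bar> \<le> C * norm v * k p"
proof -
  have "\<forall>i. \<exists>C\<ge>0. \<forall>\<^sub>F r in F. \<forall>p\<in>S r. \<bar>A i p\<bar> \<le> C * k p"
    by (rule allI, rule assms(1))
  from choice[OF this] obtain C
    where "\<forall>i. C i \<ge> 0 \<and> (\<forall>\<^sub>F r in F. \<forall>p\<in>S r. \<bar>A i p\<bar> \<le> C i * k p)"
    by (rule exE)
  then have C: "C i \<ge> 0" "\<forall>\<^sub>F r in F. \<forall>p\<in>S r. \<bar>A i p\<bar> \<le> C i * k p" for i
    by simp_all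
  from eventually_linear_bound_Basis[OF C(2) assms(2)] show ?thesis
    using C(1) by (intro exI[of _ "\<Sum>i\<in>Basis. C i"]) (simp add: sum_nonneg)
qed

text \<open>Smallness of a neighbourhood is expressed throughout as \<open>eventually\<close> in its
  radius along \<open>at_right 0\<close>, so that several requirements combine without taking minima
  by hand.\<close>

lemma eventually_box:
  fixes x0 :: "'a::metric_space" and y0 :: "'b::metric_space"
  assumes "eventually P (nhds (x0, y0))"
  shows "\<forall>\<^sub>F r in at_right 0. \<forall>p\<in>ball x0 r \<times> ball y0 r. P p"
proof -
  obtain d where d: "d > 0" "\<And>p. dist p (x0, y0) < d \<Longrightarrow> P p"
    using assms unfolding eventually_nhds_metric by blast
  have "P (x, y)" if "0 < r" "r < d / 2" "x \<in> ball x0 r" "y \<in> ball y0 r" for r x y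
  proof (rule d)
    have "dist (x, y) (x0, y0) \<le> dist x x0 + dist y y0"
      by (simp add: dist_Pair_Pair sqrt_sum_squares_le_sum)
    then show "dist (x, y) (x0, y0) < d" using that by (simp add: dist_commute)
  qed
  then show ?thesis
    unfolding eventually_at_right_field using d(1) by (intro exI[of _ "d / 2"]) auto
qed

lemma partial_derivatives:
  fixes G :: "'a::real_normed_vector \<times> 'b::real_normed_vector \<Rightarrow> real"
  assumes "G differentiable (at (x, y))"
  shows "((\<lambda>y. G (x, y)) has_derivative (\<lambda>w. dird (0, w) G (x, y))) (at y)"
    and "((\<lambda>x. G (x, y)) has_derivative (\<lambda>v. dird (v, 0) G (x, y))) (at x)"
proof -
  have "((\<lambda>y. (x, y)) has_derivative (\<lambda>w. (0, w))) (at y)"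
    by (auto intro!: derivative_eq_intros)
  from has_derivative_compose[of "\<lambda>y. (x, y)" _ y _ G, OF this has_derivative_dird[OF assms]]
  show "((\<lambda>y. G (x, y)) has_derivative (\<lambda>w. dird (0, w) G (x, y))) (at y)" .
  have "((\<lambda>x. (x, y)) has_derivative (\<lambda>v. (v, 0))) (at x)"
    by (auto intro!: derivative_eq_intros)
  from has_derivative_compose[of "\<lambda>x. (x, y)" _ x _ G, OF this has_derivative_dird[OF assms]]
  show "((\<lambda>x. G (x, y)) has_derivative (\<lambda>v. dird (v, 0) G (x, y))) (at x)" .
qed

lemma mvt_has_derivative_convex:
  fixes h :: "'a::real_normed_vector \<Rightarrow> real"
  assumes "\<And>z. z \<in> C \<Longrightarrow> (h has_derivative h' z) (at z)" "convex C" "a \<in> C" "b \<in> C"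
  shows "\<exists>z\<in>C. h b - h a = h' z (b - a)"
proof -
  have "\<exists>z\<in>C. h b - h a = dird (b - a) h z"
    using assms(1) by (intro mvt_dird_convex assms(2-)) (auto simp: differentiable_def)
  then show ?thesis using dird_eqI[OF assms(1)] by auto
qed

section \<open>Local expansions around a fixed pair of points\<close>

context
  fixes N :: "('a::euclidean_space \<times> 'a) set" and x0 y0 :: 'a
  assumes openN: "open N" and z0N: "(x0, y0) \<in> N"
begin

abbreviation (input) box0 :: "real \<Rightarrow> ('a \<times> 'a) set" where
  "box0 r \<equiv> ball x0 r \<times> ball y0 r"

lemma eventually_box_subset: "\<forall>\<^sub>F r in at_right 0. box0 r \<subseteq> N"
  using eventually_box[OF eventually_nhds_in_open[OF openN z0N]] by eventually_elim auto

lemma dird_close: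
  fixes e :: real
  assumes G: "Ck_on 1 N G" and e: "e > 0"
  shows "\<forall>\<^sub>F r in at_right 0. \<forall>p\<in>box0 r \<times> box0 r. \<forall>v. \<bar>dird v G (fst p) - dird v G (snd p)\<bar> \<le> e * norm v"
proof -
  let ?n = "real (card (Basis :: ('a \<times> 'a) set))"
  have n: "?n > 0" by (simp add: card_gt_0_iff)
  have "\<forall>\<^sub>F r in at_right 0. \<forall>p\<in>box0 r \<times> box0 r.
      \<forall>v. \<bar>dird v G (fst p) - dird v G (snd p)\<bar> \<le> (\<Sum>i\<in>(Basis :: ('a \<times> 'a) set). e / ?n) * norm v * 1"
  proof (rule eventually_linear_bound_Basis)
    fix i :: "'a \<times> 'a" assume "i \<in> Basis"
    have "isCont (dird i G) (x0, y0)"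
      using Ck_on_1D(3)[OF G] openN z0N continuous_on_eq_continuous_at by blast
    \<comment> \<open>One half for each of the two points, since they are compared through the
      centre, and an equal share of \<open>e\<close> for each basis direction.\<close>
    then have "\<forall>\<^sub>F z in nhds (x0, y0). dist (dird i G z) (dird i G (x0, y0)) < e / ?n / 2"
      unfolding isCont_def tendsto_iff eventually_nhds_conv_at using e n by auto
    from eventually_box[OF this]
    show "\<forall>\<^sub>F r in at_right 0. \<forall>p\<in>box0 r \<times> box0 r. \<bar>dird i G (fst p) - dird i G (snd p)\<bar> \<le> e / ?n * 1"
    proof eventually_elim
      case (elim r)
      show ?case
      proof
        fix p assume "p \<in> box0 r \<times> box0 r"
        then have "dist (dird i G (fst p)) (dird i G (x0, y0)) < e / ?n / 2"
          "dist (dird i G (snd p)) (dird i G (x0, y0)) < e / ?n / 2"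
          using elim by auto
        then show "\<bar>dird i G (fst p) - dird i G (snd p)\<bar> \<le> e / ?n * 1"
          by (metis dist_real_def dist_triangle_half_l less_imp_le mult.right_neutral)
      qed
    qed
  next
    show "\<forall>\<^sub>F r in at_right 0. \<forall>p\<in>box0 r \<times> box0 r. linear (\<lambda>v. dird v G (fst p) - dird v G (snd p))"
      using eventually_box_subset
    proof eventually_elim
      case (elim r)
      then show ?case by (auto intro!: linear_compose_sub linear_dird Ck_on_1D(2)[OF G])
    qed
  qed
  then show ?thesis using n by simp
qed

lemma C1_locally_lipschitz:
  assumes G: "Ck_on 1 N G"
  shows "\<exists>C\<ge>0. \<forall>\<^sub>F r in at_right 0. \<forall>p\<in>box0 r \<times> box0 r. \<bar>G (fst p) - G (snd p)\<bar> \<le> C * norm (fst p - snd p)"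
proof -
  \<comment> \<open>The sum bounds the derivative at the centre; the summand 1 absorbs its variation
    over a small box, by \<open>dird_close\<close> with the bound 1.\<close>
  define C where "C = (\<Sum>i\<in>(Basis :: ('a \<times> 'a) set). \<bar>dird i G (x0, y0)\<bar>) + 1"
  have bd: "\<bar>dird v G (x0, y0)\<bar> \<le> (C - 1) * norm v" for v
    unfolding C_def using linear_bound_Basis[OF linear_dird[OF Ck_on_1D(2)[OF G z0N]] order.refl, of v]
    by simp
  have "C \<ge> 0" unfolding C_def by (simp add: sum_nonneg)
  moreover have "\<forall>\<^sub>F r in at_right 0. \<forall>p\<in>box0 r \<times> box0 r. \<bar>G (fst p) - G (snd p)\<bar> \<le> C * norm (fst p - snd p)"
    using eventually_box_subset dird_close[OF G zero_less_one] eventually_at_right_less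
  proof eventually_elim
    case (elim r)
    show ?case
    proof
      fix p assume p: "p \<in> box0 r \<times> box0 r"
      have "\<exists>z\<in>box0 r. G (fst p) - G (snd p) = dird (fst p - snd p) G z"
        using p elim(1) by (intro mvt_dird_convex convex_Times Ck_on_1D(2)[OF G]) auto
      then obtain z where z: "z \<in> box0 r" "G (fst p) - G (snd p) = dird (fst p - snd p) G z" by blast
      have "(x0, y0) \<in> box0 r" using elim(3) by simp
      then have "\<bar>dird (fst p - snd p) G z - dird (fst p - snd p) G (x0, y0)\<bar> \<le> norm (fst p - snd p)"
        using bspec[OF elim(2), of "(z, (x0, y0))", THEN spec, of "fst p - snd p"] z(1) by simp
      then show "\<bar>G (fst p) - G (snd p)\<bar> \<le> C * norm (fst p - snd p)"
        using z(2) bd[of "fst p - snd p"] by (simp add: algebra_simps)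
    qed
  qed
  ultimately show ?thesis by blast
qed

text \<open>A single continuous derivative yields only one increment, here in \<open>y\<close>; the
  difference in \<open>x\<close> pays for the small factor. The mean value theorem is applied to
  \<open>G (x, y) - G (x', y)\<close>, whose derivative compares two nearby values.\<close>

lemma mixed_difference_small:
  fixes e :: real
  assumes G: "Ck_on 1 N G" and e: "e > 0"
  shows "\<forall>\<^sub>F r in at_right 0. \<forall>x\<in>ball x0 r. \<forall>x'\<in>ball x0 r. \<forall>y\<in>ball y0 r. \<forall>y'\<in>ball y0 r.
    \<bar>G (x, y) - G (x, y') - G (x', y) + G (x', y')\<bar> \<le> e * norm (y - y')"
  using eventually_box_subset dird_close[OF G e]
proof eventually_elim
  case (elim r)
  show ?case
  proof (intro ballI)
    fix x x' y y' assume xy: "x \<in> ball x0 r" "x' \<in> ball x0 r" "y \<in> ball y0 r" "y' \<in> ball y0 r"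
    have d: "G differentiable (at z)" if "z \<in> N" for z
      using Ck_on_1D(2)[OF G that] .
    have "\<exists>z\<in>ball y0 r. (\<lambda>y. G (x, y) - G (x', y)) y - (\<lambda>y. G (x, y) - G (x', y)) y' =
        (\<lambda>w. dird (0, w) G (x, z) - dird (0, w) G (x', z)) (y - y')"
      using xy elim(1)
      by (intro mvt_has_derivative_convex has_derivative_diff partial_derivatives d) auto
    then obtain z where z: "z \<in> ball y0 r" "G (x, y) - G (x', y) - (G (x, y') - G (x', y')) =
        dird (0, y - y') G (x, z) - dird (0, y - y') G (x', z)" by auto
    then show "\<bar>G (x, y) - G (x, y') - G (x', y) + G (x', y')\<bar> \<le> e * norm (y - y')"
      using bspec[OF elim(2), of "((x, z), (x', z))", THEN spec, of "(0, y - y')"] xy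
      by (simp add: norm_Pair algebra_simps)
  qed
qed

text \<open>Basis directions are covered by \<open>mixed_difference_small\<close>, the others by
  linearity. The corners of the rectangle are packed into the single parameter \<open>p\<close>
  because \<open>eventually_linear_bound_Basis\<close> quantifies over one parameter.\<close>

lemma mixed_difference_dird_small:
  fixes e :: real
  assumes g: "Ck_on 2 N g" and e: "e > 0"
  shows "\<forall>\<^sub>F r in at_right 0. \<forall>p\<in>box0 r \<times> box0 r. \<forall>v.
    \<bar>dird v g (fst p) - dird v g (fst (fst p), snd (snd p)) - dird v g (fst (snd p), snd (fst p)) + dird v g (snd p)\<bar>
      \<le> e * norm v * norm (snd (fst p) - snd (snd p))"
proof -
  let ?n = "real (card (Basis :: ('a \<times> 'a) set))"
  have n: "?n > 0" by (simp add: card_gt_0_iff)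
  have g': "Ck_on 1 N (dird v g)" "z \<in> N \<Longrightarrow> g differentiable (at z)" for v z
    using Ck_on_2D[OF g] by auto
  have "\<forall>\<^sub>F r in at_right 0. \<forall>p\<in>box0 r \<times> box0 r. \<forall>v.
    \<bar>dird v g (fst p) - dird v g (fst (fst p), snd (snd p)) - dird v g (fst (snd p), snd (fst p)) + dird v g (snd p)\<bar>
      \<le> (\<Sum>i\<in>(Basis :: ('a \<times> 'a) set). e / ?n) * norm v * norm (snd (fst p) - snd (snd p))"
  proof (rule eventually_linear_bound_Basis)
    fix i :: "'a \<times> 'a" assume "i \<in> Basis"
    show "\<forall>\<^sub>F r in at_right 0. \<forall>p\<in>box0 r \<times> box0 r.
      \<bar>dird i g (fst p) - dird i g (fst (fst p), snd (snd p)) - dird i g (fst (snd p), snd (fst p)) + dird i g (snd p)\<bar>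
      \<le> e / ?n * norm (snd (fst p) - snd (snd p))"
      using mixed_difference_small[OF g'(1)[of i], of "e / ?n", OF divide_pos_pos[OF e n]]
    proof eventually_elim
      case (elim r)
      show ?case
      proof
        fix p assume p: "p \<in> box0 r \<times> box0 r"
        obtain x y x' y' where pe: "p = ((x, y), (x', y'))" by (metis surj_pair)
        show "\<bar>dird i g (fst p) - dird i g (fst (fst p), snd (snd p))
            - dird i g (fst (snd p), snd (fst p)) + dird i g (snd p)\<bar>
          \<le> e / ?n * norm (snd (fst p) - snd (snd p))"
          using elim p unfolding pe mem_Times_iff fst_conv snd_conv by blast
      qed
    qed
  next
    show "\<forall>\<^sub>F r in at_right 0. \<forall>p\<in>box0 r \<times> box0 r. linear (\<lambda>v.
      dird v g (fst p) - dird v g (fst (fst p), snd (snd p)) - dird v g (fst (snd p), snd (fst p)) + dird v g (snd p))"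
      using eventually_box_subset
    proof eventually_elim
      case (elim r)
      show ?case
      proof
        fix p assume "p \<in> box0 r \<times> box0 r"
        then have "{fst p, (fst (fst p), snd (snd p)), (fst (snd p), snd (fst p)), snd p} \<subseteq> box0 r"
          unfolding mem_Times_iff insert_subset by simp
        then have "fst p \<in> N" "(fst (fst p), snd (snd p)) \<in> N" "(fst (snd p), snd (fst p)) \<in> N" "snd p \<in> N"
          using elim by blast+
        then show "linear (\<lambda>v. dird v g (fst p) - dird v g (fst (fst p), snd (snd p))
            - dird v g (fst (snd p), snd (fst p)) + dird v g (snd p))"
          by (intro linear_compose_sub linear_compose_add linear_dird g'(2))
      qed
    qed
  qed
  then show ?thesis using n by simp
qed

text \<open>The mean value theorem in \<open>y\<close> is applied to the increment of
  \<open>g\<close> between \<open>x0\<close> and \<open>x\<close>; moving the intermediate point to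
  \<open>y0\<close> costs only a mixed difference of first derivatives.\<close>

lemma mixed_taylor:
  fixes e :: real
  assumes g: "Ck_on 2 N g" and e: "e > 0"
  shows "\<forall>\<^sub>F r in at_right 0. \<forall>p\<in>box0 r.
    \<bar>g p - g (x0, snd p) - g (fst p, y0) + g (x0, y0)
      - (dird (0, snd p - y0) g (fst p, y0) - dird (0, snd p - y0) g (x0, y0))\<bar>
      \<le> e * (norm (snd p - y0))\<^sup>2"
  using eventually_box_subset mixed_difference_dird_small[OF g e] eventually_at_right_less
proof eventually_elim
  case (elim r)
  show ?case
  proof
    fix p assume p: "p \<in> box0 r"
    obtain x y where xy: "p = (x, y)" by (cases p)
    \<comment> \<open>Seeking the intermediate point in this ball instead of
      \<open>ball y0 r\<close> gives |z - y0| \<le> |y - y0|, which produces the square in the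
      error.\<close>
    let ?C = "cball y0 (norm (y - y0))"
    have C: "?C \<subseteq> ball y0 r" using p xy by (auto simp: dist_norm norm_minus_commute)
    have x: "x \<in> ball x0 r" "x0 \<in> ball x0 r" "y0 \<in> ball y0 r" "y0 \<in> ?C" "y \<in> ?C"
      using p xy elim(3) by (auto simp: dist_norm norm_minus_commute)
    have d: "g differentiable (at z)" if "z \<in> N" for z
      using Ck_on_2D(2)[OF g that] .
    have "\<exists>z\<in>?C. (\<lambda>y. g (x, y) - g (x0, y)) y - (\<lambda>y. g (x, y) - g (x0, y)) y0 =
        (\<lambda>w. dird (0, w) g (x, z) - dird (0, w) g (x0, z)) (y - y0)"
    proof (intro mvt_has_derivative_convex has_derivative_diff partial_derivatives d)
      fix z assume "z \<in> ?C"
      then have "z \<in> ball y0 r" using C by blast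
      then show "(x, z) \<in> N" "(x0, z) \<in> N" using elim(1) x by auto
    qed (use x in auto)
    then obtain z where z: "z \<in> ?C" "g (x, y) - g (x0, y) - (g (x, y0) - g (x0, y0)) =
        dird (0, y - y0) g (x, z) - dird (0, y - y0) g (x0, z)" by auto
    have zy: "norm (z - y0) \<le> norm (y - y0)" using z(1) by (simp add: dist_norm norm_minus_commute)
    have "\<bar>dird (0, y - y0) g (x, z) - dird (0, y - y0) g (x, y0) - dird (0, y - y0) g (x0, z) + dird (0, y - y0) g (x0, y0)\<bar>
        \<le> e * norm (y - y0) * norm (z - y0)"
      using bspec[OF elim(2), of "((x, z), (x0, y0))", THEN spec, of "(0, y - y0)"] x subsetD[OF C z(1)]
      by (simp add: norm_Pair)
    also have "\<dots> \<le> e * norm (y - y0) * norm (y - y0)"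
      using zy e by (intro mult_left_mono) auto
    finally show "\<bar>g p - g (x0, snd p) - g (fst p, y0) + g (x0, y0)
      - (dird (0, snd p - y0) g (fst p, y0) - dird (0, snd p - y0) g (x0, y0))\<bar>
      \<le> e * (norm (snd p - y0))\<^sup>2"
      using z(2) xy by (simp add: power2_eq_square algebra_simps)
  qed
qed

lemma mixed_taylor_dird:
  fixes e :: real
  assumes F: "Ck_on 3 N F" and e: "e > 0"
  shows "\<forall>\<^sub>F r in at_right 0. \<forall>p\<in>box0 r. \<forall>v.
    \<bar>dird v F p - dird v F (x0, snd p) - dird v F (fst p, y0) + dird v F (x0, y0)
      - (dird (0, snd p - y0) (dird v F) (fst p, y0) - dird (0, snd p - y0) (dird v F) (x0, y0))\<bar>
      \<le> e * norm v * (norm (snd p - y0))\<^sup>2"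
proof -
  let ?n = "real (card (Basis :: ('a \<times> 'a) set))"
  have n: "?n > 0" by (simp add: card_gt_0_iff)
  let ?A = "\<lambda>v p. dird v F p - dird v F (x0, snd p) - dird v F (fst p, y0) + dird v F (x0, y0)
      - (dird (0, snd p - y0) (dird v F) (fst p, y0) - dird (0, snd p - y0) (dird v F) (x0, y0))"
  have "\<forall>\<^sub>F r in at_right 0. \<forall>p\<in>box0 r. \<forall>v. \<bar>?A v p\<bar>
      \<le> (\<Sum>i\<in>(Basis :: ('a \<times> 'a) set). e / ?n) * norm v * (norm (snd p - y0))\<^sup>2"
  proof (rule eventually_linear_bound_Basis)
    fix i :: "'a \<times> 'a" assume "i \<in> Basis"
    show "\<forall>\<^sub>F r in at_right 0. \<forall>p\<in>box0 r. \<bar>?A i p\<bar> \<le> e / ?n * (norm (snd p - y0))\<^sup>2"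
      by (rule mixed_taylor[OF Ck_on_3D(3)[OF F] divide_pos_pos[OF e n]])
  next
    have F2: "Ck_on 2 N F" using F by (rule Ck_on_le) simp
    show "\<forall>\<^sub>F r in at_right 0. \<forall>p\<in>box0 r. linear (\<lambda>v. ?A v p)"
      using eventually_box_subset
    proof eventually_elim
      case (elim r)
      show ?case
      proof
        fix p assume p: "p \<in> box0 r"
        then have "{p, (x0, snd p), (fst p, y0)} \<subseteq> box0 r"
          unfolding mem_Times_iff insert_subset by (auto intro: le_less_trans[OF zero_le_dist])
        then have N: "p \<in> N" "(x0, snd p) \<in> N" "(fst p, y0) \<in> N" "(x0, y0) \<in> N"
          using elim z0N by blast+
        \<comment> \<open>Here \<open>v\<close> sits in the inner derivative, where linearity
          becomes available after exchanging the order of differentiation.\<close>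
        have lin: "linear (\<lambda>v. dird w (dird v F) q)" if "q \<in> N" for w q
        proof -
          have "(\<lambda>v. dird w (dird v F) q) = (\<lambda>v. dird v (dird w F) q)"
            using dird_symmetric[OF openN that F2] by blast
          then show ?thesis
            using linear_dird[OF Ck_on_2D(2)[OF Ck_on_3D(3)[OF F] that]] by simp
        qed
        then show "linear (\<lambda>v. ?A v p)"
          by (intro linear_compose_sub linear_compose_add lin linear_dird Ck_on_3D(2)[OF F] N)
      qed
    qed
  qed
  then show ?thesis using n by simp
qed

text \<open>The mean value theorem in \<open>x\<close> supplies the factor |x - x0|; expanding the
  derivative at the intermediate point by \<open>mixed_taylor_dird\<close> supplies \<open>e\<close>
  and the square. The first \<open>y\<close>-derivative stays evaluated at the moving point
  \<open>x\<close>, which is what avoids an error of order |x - x0|^2 |y - y0|.\<close>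

lemma second_mixed_expansion:
  fixes e :: real
  assumes F: "Ck_on 3 N F" and e: "e > 0"
  shows "\<forall>\<^sub>F r in at_right 0. \<forall>x\<in>ball x0 r. \<forall>y\<in>ball y0 r.
    \<bar>F (x, y) - F (x0, y) - F (x, y0) + F (x0, y0)
      - (dird (0, y - y0) F (x, y0) - dird (0, y - y0) F (x0, y0))
      - (dird (x - x0, 0) F (x0, y) - dird (x - x0, 0) F (x0, y0)
          - dird (0, y - y0) (dird (x - x0, 0) F) (x0, y0))\<bar>
      \<le> e * norm (x - x0) * (norm (y - y0))\<^sup>2"
  using eventually_box_subset mixed_taylor_dird[OF F e] eventually_at_right_less
proof eventually_elim
  case (elim r)
  show ?case
  proof (intro ballI)
    fix x y assume xy: "x \<in> ball x0 r" "y \<in> ball y0 r"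
    have F2: "Ck_on 2 N F" using F by (rule Ck_on_le) simp
    define \<eta> where "\<eta> = y - y0"
    have d: "F differentiable (at z)" "dird v F differentiable (at z)" if "z \<in> N" for z v
      using Ck_on_3D(2)[OF F that] Ck_on_2D(2)[OF Ck_on_3D(3)[OF F] that] by auto
    have N: "(z, y) \<in> N" "(z, y0) \<in> N" if "z \<in> ball x0 r" for z
      using xy that elim by auto
    let ?T = "\<lambda>x. F (x, y) - F (x, y0) - dird (0, \<eta>) F (x, y0)"
    have "\<exists>z\<in>ball x0 r. ?T x - ?T x0 = (\<lambda>v. dird (v, 0) F (z, y) - dird (v, 0) F (z, y0)
        - dird (v, 0) (dird (0, \<eta>) F) (z, y0)) (x - x0)"
      by (intro mvt_has_derivative_convex has_derivative_diff partial_derivatives d N) (use xy elim in auto)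
    then obtain z where z: "z \<in> ball x0 r" "?T x - ?T x0 = dird (x - x0, 0) F (z, y) - dird (x - x0, 0) F (z, y0)
        - dird (x - x0, 0) (dird (0, \<eta>) F) (z, y0)" by blast
    have sym: "dird (x - x0, 0) (dird (0, \<eta>) F) (z, y0) = dird (0, \<eta>) (dird (x - x0, 0) F) (z, y0)"
      by (rule dird_symmetric[OF openN N(2)[OF z(1)] F2])
    have "(z, y) \<in> box0 r" using z xy by simp
    from bspec[OF elim(2) this, THEN spec, of "(x - x0, 0)"]
    have "\<bar>dird (x - x0, 0) F (z, y) - dird (x - x0, 0) F (x0, y) - dird (x - x0, 0) F (z, y0)
        + dird (x - x0, 0) F (x0, y0)
        - (dird (0, \<eta>) (dird (x - x0, 0) F) (z, y0) - dird (0, \<eta>) (dird (x - x0, 0) F) (x0, y0))\<bar>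
      \<le> e * norm (x - x0) * (norm \<eta>)\<^sup>2"
      unfolding norm_Pair fst_conv snd_conv \<eta>_def by simp
    then show "\<bar>F (x, y) - F (x0, y) - F (x, y0) + F (x0, y0)
      - (dird (0, y - y0) F (x, y0) - dird (0, y - y0) F (x0, y0))
      - (dird (x - x0, 0) F (x0, y) - dird (x - x0, 0) F (x0, y0)
          - dird (0, y - y0) (dird (x - x0, 0) F) (x0, y0))\<bar>
      \<le> e * norm (x - x0) * (norm (y - y0))\<^sup>2"
      using z(2) sym unfolding \<eta>_def[symmetric] by linarith
  qed
qed

lemma dird_locally_lipschitz:
  assumes g: "Ck_on 2 N g"
  shows "\<exists>C\<ge>0. \<forall>\<^sub>F r in at_right 0. \<forall>p\<in>box0 r \<times> box0 r. \<forall>v.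
    \<bar>dird v g (fst p) - dird v g (snd p)\<bar> \<le> C * norm v * norm (fst p - snd p)"
proof -
  have "\<forall>\<^sub>F r in at_right 0. \<forall>p\<in>box0 r \<times> box0 r. linear (\<lambda>v. dird v g (fst p) - dird v g (snd p))"
    using eventually_box_subset
  proof eventually_elim
    case (elim r)
    then have "fst p \<in> N" "snd p \<in> N" if "p \<in> box0 r \<times> box0 r" for p
      using that unfolding mem_Times_iff[of p] by (auto dest: subsetD)
    then show ?case by (intro ballI linear_compose_sub linear_dird Ck_on_2D(2)[OF g])
  qed
  with C1_locally_lipschitz[OF Ck_on_2D(3)[OF g]] show ?thesis
    by (rule exists_linear_bound_Basis)
qed

text \<open>Each \<open>dird v F\<close> is of class C^2, so its derivative is locally Lipschitz and
  its first order remainder is quadratic. This will control the nonlinear part of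
  \<open>P\<close>.\<close>

lemma taylor_partial_dird:
  assumes F: "Ck_on 3 N F"
  shows "\<exists>C\<ge>0. \<forall>\<^sub>F r in at_right 0. \<forall>y\<in>ball y0 r. \<forall>v.
    \<bar>dird v F (x0, y) - dird v F (x0, y0) - dird (0, y - y0) (dird v F) (x0, y0)\<bar>
      \<le> C * norm v * (norm (y - y0))\<^sup>2"
proof -
  have "\<exists>C\<ge>0. \<forall>\<^sub>F r in at_right 0. \<forall>y\<in>ball y0 r.
    \<bar>dird v F (x0, y) - dird v F (x0, y0) - dird (0, y - y0) (dird v F) (x0, y0)\<bar> \<le> C * (norm (y - y0))\<^sup>2" for v
  proof -
    define g where "g = dird v F"
    have g: "Ck_on 2 N g" unfolding g_def by (rule Ck_on_3D(3)[OF F])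
    obtain C where C: "C \<ge> 0" "\<forall>\<^sub>F r in at_right 0. \<forall>p\<in>box0 r \<times> box0 r. \<forall>v.
      \<bar>dird v g (fst p) - dird v g (snd p)\<bar> \<le> C * norm v * norm (fst p - snd p)"
      using dird_locally_lipschitz[OF g] by blast
    have "\<forall>\<^sub>F r in at_right 0. \<forall>y\<in>ball y0 r.
      \<bar>g (x0, y) - g (x0, y0) - dird (0, y - y0) g (x0, y0)\<bar> \<le> C * (norm (y - y0))\<^sup>2"
      using eventually_box_subset C(2) eventually_at_right_less
    proof eventually_elim
      case (elim r)
      show ?case
      proof
        fix y assume y: "y \<in> ball y0 r"
        let ?K = "cball y0 (norm (y - y0))"
        have K: "?K \<subseteq> ball y0 r" using y by (auto simp: dist_norm norm_minus_commute)
        have "\<exists>z\<in>?K. g (x0, y) - g (x0, y0) = (\<lambda>w. dird (0, w) g (x0, z)) (y - y0)"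
        proof (intro mvt_has_derivative_convex partial_derivatives Ck_on_2D(2)[OF g])
          fix z assume "z \<in> ?K"
          then have "z \<in> ball y0 r" using K by blast
          then show "(x0, z) \<in> N" using elim by auto
        qed (auto simp: dist_norm norm_minus_commute)
        then obtain z where z: "z \<in> ?K" "g (x0, y) - g (x0, y0) = dird (0, y - y0) g (x0, z)" by blast
        have "\<bar>dird (0, y - y0) g (x0, z) - dird (0, y - y0) g (x0, y0)\<bar> \<le> C * norm (y - y0) * norm (z - y0)"
          using bspec[OF elim(2), of "((x0, z), (x0, y0))", THEN spec, of "(0, y - y0)"] subsetD[OF K z(1)] elim(3)
          by (simp add: norm_Pair)
        also have "\<dots> \<le> C * norm (y - y0) * norm (y - y0)"
          using z(1) C(1) by (intro mult_left_mono) (auto simp: dist_norm norm_minus_commute)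
        finally show "\<bar>g (x0, y) - g (x0, y0) - dird (0, y - y0) g (x0, y0)\<bar> \<le> C * (norm (y - y0))\<^sup>2"
          using z(2) by (simp add: power2_eq_square algebra_simps)
      qed
    qed
    then show ?thesis using C(1) unfolding g_def by blast
  qed
  note bound = this
  have F2: "Ck_on 2 N F" using F by (rule Ck_on_le) simp
  have "\<forall>\<^sub>F r in at_right 0. \<forall>y\<in>ball y0 r.
    linear (\<lambda>v. dird v F (x0, y) - dird v F (x0, y0) - dird (0, y - y0) (dird v F) (x0, y0))"
    using eventually_box_subset eventually_at_right_less
  proof eventually_elim
    case (elim r)
    have sym: "(\<lambda>v. dird w (dird v F) (x0, y0)) = (\<lambda>v. dird v (dird w F) (x0, y0))" for w
      using dird_symmetric[OF openN z0N F2] by blast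
    have "linear (\<lambda>v. dird w (dird v F) (x0, y0))" for w
      unfolding sym by (rule linear_dird[OF Ck_on_2D(2)[OF Ck_on_3D(3)[OF F] z0N]])
    moreover have "(x0, y) \<in> N" if "y \<in> ball y0 r" for y
      using elim that by auto
    ultimately show ?case
      using z0N by (intro ballI linear_compose_sub linear_dird Ck_on_3D(2)[OF F])
  qed
  with bound show ?thesis by (rule exists_linear_bound_Basis)
qed


end

section \<open>Estimates uniform over a compact set in the second variable\<close>

lemma eventually_at_right_compact_ball:
  fixes B :: "'b::metric_space set"
  assumes "compact B" "\<And>y. y \<in> B \<Longrightarrow> \<exists>d>0. \<forall>\<^sub>F r in F. \<forall>y'\<in>ball y d. P r y'"
  shows "\<forall>\<^sub>F r in F. \<forall>y\<in>B. P r y"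
proof -
  obtain d where d: "\<And>y. y \<in> B \<Longrightarrow> d y > 0" "\<And>y. y \<in> B \<Longrightarrow> \<forall>\<^sub>F r in F. \<forall>y'\<in>ball y (d y). P r y'"
    using assms(2) by metis
  obtain C where C: "C \<subseteq> B" "finite C" "B \<subseteq> (\<Union>y\<in>C. ball y (d y))"
  proof (rule compactE_image[OF assms(1), of B "\<lambda>y. ball y (d y)"])
    show "B \<subseteq> (\<Union>y\<in>B. ball y (d y))" using d(1) by force
  qed auto
  have "\<forall>\<^sub>F r in F. \<forall>y\<in>C. \<forall>y'\<in>ball y (d y). P r y'"
    using C d(2) by (intro eventually_ball_finite) auto
  then show ?thesis
  proof eventually_elim
    case (elim r)
    show ?case
    proof
      fix y assume "y \<in> B"
      then obtain z where "z \<in> C" "y \<in> ball z (d z)" using C(3) by blast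
      then show "P r y" using elim by blast
    qed
  qed
qed

lemma eventually_at_right_0D:
  assumes "eventually P (at_right (0::real))"
  shows "\<exists>d>0. P d"
  using eventually_happens'[OF trivial_limit_at_right_real eventually_conj[OF eventually_at_right_less assms]]
  by blast

lemma eventually_at_right_0I:
  assumes "d > (0::real)" "\<And>r. 0 < r \<Longrightarrow> r < d \<Longrightarrow> P r"
  shows "eventually P (at_right 0)"
  unfolding eventually_at_right_field using assms by blast

text \<open>Points of \<open>B\<close> may be far from \<open>y0\<close>, with no segment inside
  \<open>B\<close> to join them, so only \<open>x\<close> moves: the mean value theorem is applied
  to \<open>F (x, y) - F (x, y0)\<close>, and each of its two derivatives contributes half of
  \<open>e\<close>. A finite subcover of \<open>B\<close> makes the radius uniform.\<close>

lemma mixed_difference_uniform: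
  fixes F :: "'a::euclidean_space \<times> 'a \<Rightarrow> real" and e :: real
  assumes N: "open N" "{x0} \<times> B \<subseteq> N" and B: "compact B" "y0 \<in> B" and F: "Ck_on 1 N F" and e: "e > 0"
  shows "\<forall>\<^sub>F r in at_right 0. \<forall>x\<in>ball x0 r. \<forall>y\<in>B.
    \<bar>F (x, y) - F (x0, y) - F (x, y0) + F (x0, y0) - (dird (x - x0, 0) F (x0, y) - dird (x - x0, 0) F (x0, y0))\<bar>
      \<le> e * norm (x - x0)"
proof -
  let ?P = "\<lambda>r y. \<forall>x\<in>ball x0 r. (x, y) \<in> N \<and> (\<forall>v. \<bar>dird v F (x, y) - dird v F (x0, y)\<bar> \<le> e / 2 * norm v)"
  have "\<forall>\<^sub>F r in at_right 0. \<forall>y\<in>B. ?P r y"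
  proof (rule eventually_at_right_compact_ball[OF B(1)])
    fix y assume "y \<in> B"
    then have yN: "(x0, y) \<in> N" using N by auto
    have "e / 2 > 0" using e by simp
    from eventually_at_right_0D[OF eventually_conj[OF eventually_box_subset[OF N(1) yN] dird_close[OF N(1) yN F this]]]
    obtain d where d: "d > 0" and box: "ball x0 d \<times> ball y d \<subseteq> N"
      "\<forall>p\<in>(ball x0 d \<times> ball y d) \<times> ball x0 d \<times> ball y d.
        \<forall>v. \<bar>dird v F (fst p) - dird v F (snd p)\<bar> \<le> e / 2 * norm v"
      by (elim exE conjE) (rule that)
    have "?P r y'" if r: "0 < r" "r < d" and y': "y' \<in> ball y d" for r y'
    proof
      fix x assume "x \<in> ball x0 r"
      then have x: "x \<in> ball x0 d" "x0 \<in> ball x0 d" using r by auto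
      then have "(x, y') \<in> N" using box(1) y' by auto
      moreover have "((x, y'), (x0, y')) \<in> (ball x0 d \<times> ball y d) \<times> ball x0 d \<times> ball y d"
        using x y' by simp
      from bspec[OF box(2) this]
      have "\<forall>v. \<bar>dird v F (x, y') - dird v F (x0, y')\<bar> \<le> e / 2 * norm v" unfolding fst_conv snd_conv .
      ultimately show "(x, y') \<in> N \<and> (\<forall>v. \<bar>dird v F (x, y') - dird v F (x0, y')\<bar> \<le> e / 2 * norm v)" by (rule conjI)
    qed
    note P = this
    have "\<forall>\<^sub>F r in at_right 0. \<forall>y'\<in>ball y d. ?P r y'"
    proof (rule eventually_at_right_0I[OF d], rule ballI)
      fix r y' assume "0 < r" "r < d" "y' \<in> ball y d"
      then show "?P r y'" by (rule P)
    qed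
    then show "\<exists>d>0. \<forall>\<^sub>F r in at_right 0. \<forall>y'\<in>ball y d. ?P r y'"
      using d by (intro exI[of _ d] conjI)
  qed
  then show ?thesis
    using eventually_at_right_less
  proof eventually_elim
    case (elim r)
    show ?case
    proof (intro ballI)
      fix x y assume xy: "x \<in> ball x0 r" "y \<in> B"
      let ?T = "\<lambda>x. F (x, y) - F (x, y0)"
      have "\<exists>z\<in>ball x0 r. ?T x - ?T x0 = (\<lambda>v. dird (v, 0) F (z, y) - dird (v, 0) F (z, y0)) (x - x0)"
        by (intro mvt_has_derivative_convex has_derivative_diff partial_derivatives Ck_on_1D(2)[OF F])
          (use xy elim B in \<open>simp_all del: split_paired_All\<close>)
      then obtain z where z: "z \<in> ball x0 r"
        "?T x - ?T x0 = dird (x - x0, 0) F (z, y) - dird (x - x0, 0) F (z, y0)" by blast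
      have "\<bar>dird (x - x0, 0) F (z, y') - dird (x - x0, 0) F (x0, y')\<bar> \<le> e / 2 * norm (x - x0)"
        if "y' \<in> B" for y'
      proof -
        have "\<forall>v. \<bar>dird v F (z, y') - dird v F (x0, y')\<bar> \<le> e / 2 * norm v"
          using bspec[OF bspec[OF elim(1) that] z(1)] by (rule conjunct2)
        from spec[OF this, of "(x - x0, 0)"] show ?thesis by (simp add: norm_Pair)
      qed
      from this[OF xy(2)] this[OF B(2)] z(2)
      show "\<bar>F (x, y) - F (x0, y) - F (x, y0) + F (x0, y0)
          - (dird (x - x0, 0) F (x0, y) - dird (x - x0, 0) F (x0, y0))\<bar> \<le> e * norm (x - x0)"
        by linarith
    qed
  qed
qed

section \<open>The expansions in terms of the gradients of the cost\<close>

lemma inner_grad: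
  assumes "(f has_derivative f') (at x)"
  shows "inner (grad f x) v = f' v"
proof -
  have f: "frechet_derivative f (at x) = f'" using assms frechet_derivative_at by metis
  interpret linear f' using assms has_derivative_linear by blast
  have "f' v = f' (\<Sum>b\<in>Basis. inner v b *\<^sub>R b)" by (simp add: euclidean_representation)
  also have "\<dots> = (\<Sum>b\<in>Basis. inner v b * f' b)" by (simp add: sum scale)
  finally show ?thesis unfolding grad_def f by (simp add: inner_commute[of _ v] inner_sum_right mult.commute)
qed

lemma inner_Dx:
  assumes "case_prod c differentiable (at (x, y))"
  shows "inner (Dx c x y) v = dird (v, 0) (case_prod c) (x, y)"
  using inner_grad partial_derivatives(2)[OF assms] unfolding Dx_def by fastforce

lemma inner_Dy:
  assumes "case_prod c differentiable (at (x, y))"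
  shows "inner (Dy c x y) v = dird (0, v) (case_prod c) (x, y)"
  using inner_grad partial_derivatives(1)[OF assms] unfolding Dy_def by fastforce

lemma norm_le_of_inner:
  fixes a :: "'a::real_inner"
  assumes "\<And>v. \<bar>inner a v\<bar> \<le> k * norm v" "k \<ge> 0"
  shows "norm a \<le> k"
proof (cases "a = 0")
  case False
  then show ?thesis using assms(1)[of a] by (simp add: dot_square_norm power2_eq_square)
qed (use assms in simp)

text \<open>\<open>M\<close> is minus the mixed second derivative of the cost; by symmetry of second
  derivatives its transpose is the derivative of \<open>Q\<close>, and this couples the two
  variables. Since \<open>f\<close> is minus the mixed difference of the cost, the two correction
  terms of \<open>second_mixed_expansion\<close> turn into the inner products with the increment of
  \<open>Q\<close> and with the nonlinear part of \<open>P\<close>.\<close>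

lemma cost_expansion:
  fixes c :: "'a::euclidean_space \<Rightarrow> 'a \<Rightarrow> real"
  assumes N: "open N" "(x0, y0) \<in> N" and c: "Ck_on 3 N (case_prod c)"
  defines "P \<equiv> \<lambda>y. - Dx c x0 y" and "Q \<equiv> \<lambda>x. - Dy c x y0"
    and "f \<equiv> \<lambda>x y. c x0 y + c x y0 - c x y - c x0 y0"
  shows "\<exists>M. linear M \<and> (P has_derivative M) (at y0) \<and> (Q has_derivative adjoint M) (at x0) \<and>
    (\<forall>e>0. \<forall>\<^sub>F r in at_right 0. \<forall>x\<in>ball x0 r. \<forall>y\<in>ball y0 r.
      \<bar>f x y - inner (Q x - Q x0) (y - y0) - inner (P y - P y0 - M (y - y0)) (x - x0)\<bar>
        \<le> e * norm (x - x0) * (norm (y - y0))\<^sup>2) \<and>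
    (\<exists>C\<ge>0. \<forall>\<^sub>F r in at_right 0. \<forall>y\<in>ball y0 r. norm (P y - P y0 - M (y - y0)) \<le> C * (norm (y - y0))\<^sup>2) \<and>
    (\<exists>L\<ge>0. \<forall>\<^sub>F r in at_right 0. \<forall>x\<in>ball x0 r. \<forall>x'\<in>ball x0 r. norm (Q x - Q x') \<le> L * norm (x - x'))"
proof -
  define F where "F = case_prod c"
  have F3: "Ck_on 3 N F" using c by (simp add: F_def)
  have F2: "Ck_on 2 N F" using F3 by (rule Ck_on_le) simp
  define M where "M \<eta> = (\<Sum>b\<in>Basis. - (dird (0, \<eta>) (dird (b, 0) F) (x0, y0)) *\<^sub>R b)" for \<eta>
  have dd: "dird v F differentiable (at z)" if "z \<in> N" for v z
    using Ck_on_2D(2)[OF Ck_on_3D(3)[OF F3] that] .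
  have sym: "dird w (dird v F) (x0, y0) = dird v (dird w F) (x0, y0)" for v w
    by (rule dird_symmetric[OF N F2])
  have M: "inner (M \<eta>) v = - dird (0, \<eta>) (dird (v, 0) F) (x0, y0)" for \<eta> v
  proof -
    interpret linear "\<lambda>v. dird (0, \<eta>) (dird (v, 0) F) (x0, y0)"
    proof -
      have "linear (\<lambda>v. dird v (dird (0, \<eta>) F) (x0, y0))" by (rule linear_dird[OF dd[OF N(2)]])
      moreover have "linear (\<lambda>v. (v, 0::'a))" by (simp add: linear_iff)
      ultimately have "linear ((\<lambda>v. dird v (dird (0, \<eta>) F) (x0, y0)) \<circ> (\<lambda>v. (v, 0::'a)))"
        by (rule linear_compose[rotated])
      then show "linear (\<lambda>v. dird (0, \<eta>) (dird (v, 0) F) (x0, y0))" unfolding o_def sym .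
    qed
    have "dird (0, \<eta>) (dird (v, 0) F) (x0, y0)
        = dird (0, \<eta>) (dird (\<Sum>b\<in>Basis. inner v b *\<^sub>R b, 0) F) (x0, y0)"
      by (simp only: euclidean_representation)
    also have "\<dots> = (\<Sum>b\<in>Basis. inner v b * dird (0, \<eta>) (dird (b, 0) F) (x0, y0))"
      by (simp only: sum scale real_scaleR_def)
    finally show ?thesis
      unfolding M_def by (simp add: inner_commute[of _ v] inner_sum_right sum_negf mult.commute)
  qed
  have P: "inner (P y) v = - dird (v, 0) F (x0, y)" if "(x0, y) \<in> N" for y v
    unfolding P_def F_def using inner_Dx[of c x0 y] Ck_on_3D(2)[OF c that] by simp
  have Q: "inner (Q x) v = - dird (0, v) F (x, y0)" if "(x, y0) \<in> N" for x v
    unfolding Q_def F_def using inner_Dy[of c x y0] Ck_on_3D(2)[OF c that] by simp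
  have DP: "(P has_derivative M) (at y0)"
  proof (rule has_derivative_componentwise_within[where S=UNIV, THEN iffD2], rule ballI)
    fix b :: 'a assume "b \<in> Basis"
    have op: "open {y. (x0, y) \<in> N}"
      using open_vimage[OF N(1), of "\<lambda>y. (x0, y)"] by (simp add: vimage_def continuous_intros)
    have "((\<lambda>y. - dird (b, 0) F (x0, y)) has_derivative (\<lambda>\<eta>. - dird (0, \<eta>) (dird (b, 0) F) (x0, y0))) (at y0)"
      by (intro has_derivative_minus partial_derivatives dd N)
    then show "((\<lambda>y. inner (P y) b) has_derivative (\<lambda>\<eta>. inner (M \<eta>) b)) (at y0)"
      unfolding M by (rule has_derivative_transform_within_open[OF _ op]) (simp_all only: mem_Collect_eq N P)
  qed
  have linM: "linear M" using DP has_derivative_linear by blast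
  have DQ: "(Q has_derivative adjoint M) (at x0)"
  proof (rule has_derivative_componentwise_within[where S=UNIV, THEN iffD2], rule ballI)
    fix b :: 'a assume "b \<in> Basis"
    have op: "open {x. (x, y0) \<in> N}"
      using open_vimage[OF N(1), of "\<lambda>x. (x, y0)"] by (simp add: vimage_def continuous_intros)
    have adj: "inner (adjoint M \<delta>) b = - dird (\<delta>, 0) (dird (0, b) F) (x0, y0)" for \<delta>
      using adjoint_works[OF linM, of b \<delta>] M[of b \<delta>] sym[of "(0, b)" "(\<delta>, 0)"] by (simp add: inner_commute)
    have "((\<lambda>x. - dird (0, b) F (x, y0)) has_derivative (\<lambda>\<delta>. - dird (\<delta>, 0) (dird (0, b) F) (x0, y0))) (at x0)"
      by (intro has_derivative_minus partial_derivatives dd N)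
    then show "((\<lambda>x. inner (Q x) b) has_derivative (\<lambda>\<delta>. inner (adjoint M \<delta>) b)) (at x0)"
      unfolding adj by (rule has_derivative_transform_within_open[OF _ op]) (simp_all only: mem_Collect_eq N Q)
  qed
  have near: "\<forall>\<^sub>F r in at_right 0. \<forall>x\<in>ball x0 r. \<forall>y\<in>ball y0 r.
      \<bar>f x y - inner (Q x - Q x0) (y - y0) - inner (P y - P y0 - M (y - y0)) (x - x0)\<bar>
        \<le> e * norm (x - x0) * (norm (y - y0))\<^sup>2" if "e > 0" for e
    using second_mixed_expansion[OF N F3 that] eventually_box_subset[OF N] eventually_at_right_less
  proof eventually_elim
    case (elim r)
    show ?case
    proof (intro ballI)
      fix x y assume xy: "x \<in> ball x0 r" "y \<in> ball y0 r"
      then have xyN: "(x, y0) \<in> N" "(x0, y) \<in> N" using elim by auto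
      have eq: "f x y - inner (Q x - Q x0) (y - y0) - inner (P y - P y0 - M (y - y0)) (x - x0)
        = - (F (x, y) - F (x0, y) - F (x, y0) + F (x0, y0)
      - (dird (0, y - y0) F (x, y0) - dird (0, y - y0) F (x0, y0))
      - (dird (x - x0, 0) F (x0, y) - dird (x - x0, 0) F (x0, y0)
          - dird (0, y - y0) (dird (x - x0, 0) F) (x0, y0)))"
        unfolding inner_diff_left[of _ _ "y - y0"] inner_diff_left[of _ _ "x - x0"] M
          P[OF xyN(2)] P[OF N(2)] Q[OF xyN(1)] Q[OF N(2)]
        unfolding F_def f_def by simp
      show "\<bar>f x y - inner (Q x - Q x0) (y - y0) - inner (P y - P y0 - M (y - y0)) (x - x0)\<bar>
        \<le> e * norm (x - x0) * (norm (y - y0))\<^sup>2"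
        unfolding eq abs_minus_cancel using bspec[OF bspec[OF elim(1) xy(1)] xy(2)] .
    qed
  qed
  have quad: "\<exists>C\<ge>0. \<forall>\<^sub>F r in at_right 0. \<forall>y\<in>ball y0 r. norm (P y - P y0 - M (y - y0)) \<le> C * (norm (y - y0))\<^sup>2"
  proof -
    obtain C where C: "C \<ge> 0" "\<forall>\<^sub>F r in at_right 0. \<forall>y\<in>ball y0 r. \<forall>v.
      \<bar>dird v F (x0, y) - dird v F (x0, y0) - dird (0, y - y0) (dird v F) (x0, y0)\<bar>
        \<le> C * norm v * (norm (y - y0))\<^sup>2"
      using taylor_partial_dird[OF N F3] by (elim exE conjE) (rule that)
    have "\<forall>\<^sub>F r in at_right 0. \<forall>y\<in>ball y0 r. norm (P y - P y0 - M (y - y0)) \<le> C * (norm (y - y0))\<^sup>2"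
      using C(2) eventually_box_subset[OF N] eventually_at_right_less
    proof eventually_elim
      case (elim r)
      show ?case
      proof
        fix y assume y: "y \<in> ball y0 r"
        have yN: "(x0, y) \<in> N" using elim y by auto
        show "norm (P y - P y0 - M (y - y0)) \<le> C * (norm (y - y0))\<^sup>2"
        proof (rule norm_le_of_inner)
          fix v
          have "inner (P y - P y0 - M (y - y0)) v = - (dird (v, 0) F (x0, y) - dird (v, 0) F (x0, y0)
              - dird (0, y - y0) (dird (v, 0) F) (x0, y0))"
            unfolding inner_diff_left[of _ _ v] M P[OF yN] P[OF N(2)] by simp
          then show "\<bar>inner (P y - P y0 - M (y - y0)) v\<bar> \<le> C * (norm (y - y0))\<^sup>2 * norm v"
            using spec[OF bspec[OF elim(1) y], of "(v, 0)"] by (simp add: norm_Pair mult_ac)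
        qed (use C in simp)
      qed
    qed
    with C(1) show ?thesis by (intro exI[of _ C] conjI)
  qed
  have lip: "\<exists>L\<ge>0. \<forall>\<^sub>F r in at_right 0. \<forall>x\<in>ball x0 r. \<forall>x'\<in>ball x0 r. norm (Q x - Q x') \<le> L * norm (x - x')"
  proof -
    obtain C where C: "C \<ge> 0" "\<forall>\<^sub>F r in at_right 0. \<forall>p\<in>(ball x0 r \<times> ball y0 r) \<times> ball x0 r \<times> ball y0 r. \<forall>v.
      \<bar>dird v F (fst p) - dird v F (snd p)\<bar> \<le> C * norm v * norm (fst p - snd p)"
      using dird_locally_lipschitz[OF N F2] by (elim exE conjE) (rule that)
    have "\<forall>\<^sub>F r in at_right 0. \<forall>x\<in>ball x0 r. \<forall>x'\<in>ball x0 r. norm (Q x - Q x') \<le> C * norm (x - x')"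
      using C(2) eventually_box_subset[OF N] eventually_at_right_less
    proof eventually_elim
      case (elim r)
      show ?case
      proof (intro ballI)
        fix x x' assume x: "x \<in> ball x0 r" "x' \<in> ball x0 r"
        have xN: "(x, y0) \<in> N" "(x', y0) \<in> N" using elim x by auto
        have mem: "((x, y0), (x', y0)) \<in> (ball x0 r \<times> ball y0 r) \<times> ball x0 r \<times> ball y0 r"
          using x elim by simp
        show "norm (Q x - Q x') \<le> C * norm (x - x')"
        proof (rule norm_le_of_inner)
          fix v
          have "inner (Q x - Q x') v = - (dird (0, v) F (x, y0) - dird (0, v) F (x', y0))"
            unfolding inner_diff_left[of _ _ v] Q[OF xN(1)] Q[OF xN(2)] by simp
          then show "\<bar>inner (Q x - Q x') v\<bar> \<le> C * norm (x - x') * norm v"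
            using spec[OF bspec[OF elim(1) mem], of "(0, v)"] by (simp add: norm_Pair mult_ac)
        qed (use C in simp)
      qed
    qed
    with C(1) show ?thesis by (intro exI[of _ C] conjI)
  qed
  show ?thesis
    using linM DP DQ near quad lip by (intro exI[of _ M] conjI allI impI)
qed

text \<open>For image points far from \<open>y0\<close>, out of reach of the local expansion. First
  order in \<open>x\<close> suffices there, because strict convexity keeps the component of
  \<open>P y - P y0\<close> along the normal away from zero.\<close>

lemma cost_expansion_uniform:
  fixes c :: "'a::euclidean_space \<Rightarrow> 'a \<Rightarrow> real"
  assumes N: "open N" "{x0} \<times> B \<subseteq> N" and B: "compact B" "y0 \<in> B"
    and c: "Ck_on 1 N (case_prod c)" and e: "e > 0"
  defines "P \<equiv> \<lambda>y. - Dx c x0 y"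
    and "f \<equiv> \<lambda>x y. c x0 y + c x y0 - c x y - c x0 y0"
  shows "\<forall>\<^sub>F r in at_right 0. \<forall>x\<in>ball x0 r. \<forall>y\<in>B.
    \<bar>f x y - inner (P y - P y0) (x - x0)\<bar> \<le> e * norm (x - x0)"
  using mixed_difference_uniform[OF N B c e]
proof eventually_elim
  case (elim r)
  show ?case
  proof (intro ballI)
    fix x y assume xy: "x \<in> ball x0 r" "y \<in> B"
    have P: "inner (P y) v = - dird (v, 0) (case_prod c) (x0, y)" if "y \<in> B" for y v
      unfolding P_def using inner_Dx[of c x0 y] Ck_on_1D(2)[OF c, of "(x0, y)"] N(2) that by auto
    have eq: "f x y - inner (P y - P y0) (x - x0)
      = - (c x y - c x0 y - c x y0 + c x0 y0 - (dird (x - x0, 0) (case_prod c) (x0, y) - dird (x - x0, 0) (case_prod c) (x0, y0)))"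
      unfolding inner_diff_left[of _ _ "x - x0"] P[OF xy(2)] P[OF B(2)] unfolding f_def by simp
    show "\<bar>f x y - inner (P y - P y0) (x - x0)\<bar> \<le> e * norm (x - x0)"
      unfolding eq abs_minus_cancel using bspec[OF bspec[OF elim xy(1)] xy(2)] by simp
  qed
qed

section \<open>Measures of curved cones and slabs\<close>

lemma measure_lebesgue_ball:
  fixes x :: "'a::euclidean_space"
  assumes "r \<ge> 0"
  shows "measure lebesgue (ball x r) = unit_ball_vol (DIM('a)) * r ^ DIM('a)"
    and "measure lebesgue (cball x r) = unit_ball_vol (DIM('a)) * r ^ DIM('a)"
proof -
  show "measure lebesgue (ball x r) = unit_ball_vol (DIM('a)) * r ^ DIM('a)"
    using content_ball[OF assms] by simp
  then show "measure lebesgue (cball x r) = unit_ball_vol (DIM('a)) * r ^ DIM('a)"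
    using content_cball_conv_ball[of x r] by simp
qed

text \<open>Disjoint translates of the slab along its thin direction still fit in a ball of radius
  \<open>O(\<theta>)\<close>, so no integration is needed.\<close>

lemma measure_slab_le:
  fixes w y0 :: "'a::euclidean_space"
  assumes w: "w \<noteq> 0" and A: "A > 0" and n: "n > 0"
  defines "\<theta> \<equiv> norm w / (2 * real n)"
  defines "S \<equiv> {y. norm (y - y0) \<le> A * \<theta> \<and> \<bar>inner w (y - y0)\<bar> \<le> A * \<theta>\<^sup>2}"
  shows "compact S" "real n * measure lebesgue S \<le> unit_ball_vol (DIM('a)) * (5 / 2 * A * \<theta>) ^ DIM('a)"
proof -
  have \<theta>: "\<theta> > 0" unfolding \<theta>_def using w n by simp
  have S: "S = cball y0 (A * \<theta>) \<inter> {y. \<bar>inner w (y - y0)\<bar> \<le> A * \<theta>\<^sup>2}"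
    unfolding S_def by (auto simp: dist_norm norm_minus_commute)
  show cS: "compact S"
    unfolding S by (intro compact_Int_closed compact_cball closed_Collect_le continuous_intros)
  \<comment> \<open>A shift by \<open>t *\<^sub>R w\<close> raises the inner product with
    \<open>w\<close> by 3 A \<theta>^2, more than the full thickness 2 A \<theta>^2 of the
    slab.\<close>
  define t where "t = 3 * A * \<theta>\<^sup>2 / (norm w)\<^sup>2"
  have t: "t * (norm w)\<^sup>2 = 3 * A * \<theta>\<^sup>2" "t > 0" unfolding t_def using w A \<theta> by auto
  define T where "T k = (+) ((real k * t) *\<^sub>R w) ` S" for k :: nat
  have T: "T k \<in> lmeasurable" "measure lebesgue (T k) = measure lebesgue S" for k
    unfolding T_def using lmeasurable_compact[OF cS] by (auto simp: measurable_translation measure_translation)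
  have Tw: "\<bar>inner w (z - y0) - real k * (3 * A * \<theta>\<^sup>2)\<bar> \<le> A * \<theta>\<^sup>2" if "z \<in> T k" for z k
  proof -
    obtain y where y: "y \<in> S" "z = (real k * t) *\<^sub>R w + y" using \<open>z \<in> T k\<close> unfolding T_def by auto
    have "inner w (z - y0) = real k * (t * (norm w)\<^sup>2) + inner w (y - y0)"
      unfolding y(2) by (simp add: inner_simps power2_norm_eq_inner algebra_simps)
    then show ?thesis using y(1) unfolding S_def t(1) by simp
  qed
  have disj: "disjnt (T i) (T j)" if "i < j" for i j
  proof (rule ccontr)
    assume "\<not> disjnt (T i) (T j)"
    then obtain z where z: "z \<in> T i" "z \<in> T j" by (auto simp: disjnt_def)
    have pos: "A * \<theta>\<^sup>2 > 0" using A \<theta> by simp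
    have "real j * (3 * A * \<theta>\<^sup>2) \<ge> (real i + 1) * (3 * A * \<theta>\<^sup>2)"
      using that pos by (intro mult_right_mono) auto
    then have "real j * (3 * A * \<theta>\<^sup>2) - real i * (3 * A * \<theta>\<^sup>2) \<ge> 3 * (A * \<theta>\<^sup>2)" by (simp add: algebra_simps)
    then show False using Tw[OF z(1)] Tw[OF z(2)] pos by linarith
  qed
  have sub: "T k \<subseteq> cball y0 (5 / 2 * A * \<theta>)" if "k < n" for k
  proof
    fix z assume "z \<in> T k"
    then obtain y where y: "y \<in> S" "z = (real k * t) *\<^sub>R w + y" unfolding T_def by auto
    have "norm (z - y0) \<le> norm ((real k * t) *\<^sub>R w) + norm (y - y0)"
      unfolding y(2) add_diff_eq[symmetric] by (rule norm_triangle_ineq)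
    also have "norm ((real k * t) *\<^sub>R w) \<le> real n * (t * norm w)"
      using that t(2) by (simp add: mult.assoc mult_right_mono)
    also have "t * norm w = 3 * A * \<theta>\<^sup>2 / norm w" unfolding t_def using w by (simp add: power2_eq_square)
    \<comment> \<open>This is where \<open>\<theta>\<close> is tied to \<open>n\<close>: the total
      shift is at most 3/2 A \<theta>, and the slab radius A \<theta> brings it to 5/2 A
      \<theta>.\<close>
    also have "real n * (3 * A * \<theta>\<^sup>2 / norm w) = 3 / 2 * A * \<theta>"
      unfolding \<theta>_def using w n by (simp add: power2_eq_square field_simps)
    finally show "z \<in> cball y0 (5 / 2 * A * \<theta>)"
      using y(1) unfolding S_def by (simp add: dist_norm norm_minus_commute)
  qed
  have "real n * measure lebesgue S = (\<Sum>k<n. measure lebesgue (T k))" by (simp add: T)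
  also have "\<dots> = measure lebesgue (\<Union>k<n. T k)"
  proof (rule measure_UNION'[symmetric])
    show "pairwise (\<lambda>i j. disjnt (T i) (T j)) {..<n}"
      unfolding pairwise_def using disj by (metis disjnt_sym linorder_neqE_nat)
  qed (use T in auto)
  also have "\<dots> \<le> measure lebesgue (cball y0 (5 / 2 * A * \<theta>))"
    using sub T by (intro measure_mono_fmeasurable) auto
  also have "\<dots> = unit_ball_vol (DIM('a)) * (5 / 2 * A * \<theta>) ^ DIM('a)"
    using A \<theta> by (intro measure_lebesgue_ball) simp
  finally show "real n * measure lebesgue S \<le> unit_ball_vol (DIM('a)) * (5 / 2 * A * \<theta>) ^ DIM('a)" .
qed

text \<open>The cone is replaced by \<open>n\<close> disjoint balls of radius
  \<open>\<rho> * \<theta>\<close> strung along a \<open>Q\<close>-preimage of a segment in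
  direction \<open>w\<close>. As \<open>n\<close> is proportional to 1/\<theta>, their total measure
  has order \<theta>^(DIM - 1). The quantifier order matters: \<open>\<rho>\<close> must not depend
  on \<open>n\<close>.\<close>

lemma curved_cone_lower_bound:
  fixes Q :: "'a::euclidean_space \<Rightarrow> 'a" and w :: 'a
  assumes r: "r > 0" and L: "L > 0" and lip: "\<And>x x'. x \<in> ball x0 r \<Longrightarrow> x' \<in> ball x0 r \<Longrightarrow> norm (Q x - Q x') \<le> L * norm (x - x')"
    and DQ: "(Q has_derivative Q') (at x0)" "bij Q'" and w: "w \<noteq> 0"
  shows "\<exists>\<rho>>0. \<forall>n>0. norm w / (2 * real n) \<le> 1 \<longrightarrow>
    (\<exists>E. open E \<and> E \<subseteq> ball x0 r \<and>
      measure lebesgue E = real n * (unit_ball_vol (DIM('a)) * (\<rho> * (norm w / (2 * real n))) ^ DIM('a)) \<and>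
      (\<forall>x\<in>E. \<exists>s>0. norm (Q x - Q x0 - s *\<^sub>R w) \<le> norm w / (2 * real n) * s))"
proof -
  have contQ: "continuous_on (ball x0 r) Q"
    using lip by (intro lipschitz_on_continuous_on[of L] lipschitz_onI) (use L in \<open>auto simp: dist_norm\<close>)
  have linQ: "linear Q'" using DQ(1) has_derivative_linear by blast
  obtain Qi where Qi: "linear Qi" "Q' \<circ> Qi = id"
    using linear_surjective_right_inverse[OF linQ] DQ(2) bij_is_surj by blast
  have "Q x0 \<in> interior (Q ` ball x0 (r / 2))"
    \<comment> \<open>Continuity together with a right inverse of the derivative at the single point
      \<open>x0\<close> already makes the image a neighbourhood of \<open>Q x0\<close>, so points of
      the segment have preimages.\<close>
    by (rule sussmann_open_mapping[OF open_ball contQ _ DQ(1) _ Qi(2)])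
      (use r Qi in \<open>auto simp: linear_linear interior_open\<close>)
  then obtain d where d: "d > 0" "ball (Q x0) d \<subseteq> Q ` ball x0 (r / 2)"
    using mem_interior by blast
  \<comment> \<open>The first bound keeps the segment inside the ball covered by the image, the
    second makes \<open>\<rho>\<close> at most r/2.\<close>
  define s1 where "s1 = min (d / (2 * norm w)) (L * r)"
  have s1: "s1 > 0" "s1 * norm w < d" "s1 \<le> L * r"
  proof -
    show "s1 > 0" unfolding s1_def using d w L r by simp
    have "s1 * norm w \<le> d / (2 * norm w) * norm w" unfolding s1_def by (intro mult_right_mono) auto
    also have "\<dots> < d" using d w by simp
    finally show "s1 * norm w < d" .
    show "s1 \<le> L * r" by (simp add: s1_def)
  qed
  define \<rho> where "\<rho> = s1 / (2 * L)"
  have \<rho>: "\<rho> > 0" "\<rho> \<le> r / 2" "L * \<rho> = s1 / 2"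
    unfolding \<rho>_def using s1 L by (auto simp: field_simps)
  have "\<exists>x\<in>ball x0 (r / 2). Q x - Q x0 = s *\<^sub>R w" if "0 < s" "s \<le> s1" for s
  proof -
    have "s * norm w \<le> s1 * norm w" using that by (intro mult_right_mono) auto
    then have "Q x0 + s *\<^sub>R w \<in> ball (Q x0) d"
      using s1(2) that by (simp add: dist_norm)
    then show ?thesis using d(2) by (metis (no_types, lifting) add_diff_cancel_left' imageE subsetD)
  qed
  then obtain X where X: "\<And>s. 0 < s \<Longrightarrow> s \<le> s1 \<Longrightarrow> X s \<in> ball x0 (r / 2)"
    "\<And>s. 0 < s \<Longrightarrow> s \<le> s1 \<Longrightarrow> Q (X s) - Q x0 = s *\<^sub>R w" by metis
  have "\<exists>E. open E \<and> E \<subseteq> ball x0 r \<and>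
      measure lebesgue E = real n * (unit_ball_vol (DIM('a)) * (\<rho> * \<theta>) ^ DIM('a)) \<and>
      (\<forall>x\<in>E. \<exists>s>0. norm (Q x - Q x0 - s *\<^sub>R w) \<le> \<theta> * s)"
    if n: "n > 0" and \<theta>: "\<theta> = norm w / (2 * real n)" "\<theta> \<le> 1" for n and \<theta>
  proof -
    have \<theta>0: "\<theta> > 0" using \<theta> w n by simp
    \<comment> \<open>Only the outer half of the segment is used, where the admissible deviation
      \<open>\<theta> * s\<close> is at least \<theta> s1/2 = L \<rho> \<theta>, the most that
      \<open>Q\<close> can vary from the centre of a ball of radius \<rho> \<theta>.\<close>
    define \<sigma> where "\<sigma> k = s1 / 2 + real k * (s1 / (2 * real n))" for k :: nat
    have \<sigma>: "s1 / 2 \<le> \<sigma> k" "0 < \<sigma> k" "\<sigma> k \<le> s1" if "k < n" for k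
    proof -
      have "real k * (s1 / (2 * real n)) \<le> real n * (s1 / (2 * real n))"
        using that s1 by (intro mult_right_mono) auto
      then have "real k * (s1 / (2 * real n)) \<le> s1 / 2" using n by simp
      moreover have "real k * (s1 / (2 * real n)) \<ge> 0" using s1 by simp
      ultimately show "s1 / 2 \<le> \<sigma> k" "0 < \<sigma> k" "\<sigma> k \<le> s1"
        unfolding \<sigma>_def using s1(1) by linarith+
    qed
    define D where "D k = ball (X (\<sigma> k)) (\<rho> * \<theta>)" for k
    have \<rho>\<theta>: "\<rho> * \<theta> \<le> r / 2" "\<rho> * \<theta> > 0"
      using mult_left_mono[OF \<theta>(2), of \<rho>] \<rho>(1,2) \<theta>0 by linarith (simp add: \<rho>(1) \<theta>0)
    have Dsub: "D k \<subseteq> ball x0 r" if "k < n" for k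
    proof
      fix x assume "x \<in> D k"
      then have "dist (X (\<sigma> k)) x < \<rho> * \<theta>" by (simp add: D_def)
      moreover have "dist x0 (X (\<sigma> k)) < r / 2" using X(1)[OF \<sigma>(2,3)[OF that]] by simp
      ultimately show "x \<in> ball x0 r" using \<rho>\<theta>(1) dist_triangle[of x0 x "X (\<sigma> k)"] by simp
    qed
    have Xr: "X (\<sigma> k) \<in> ball x0 r" if "k < n" for k
      using X(1)[OF \<sigma>(2,3)[OF that]] r by simp
    have near: "\<exists>s>0. norm (Q x - Q x0 - s *\<^sub>R w) \<le> \<theta> * s" if "k < n" "x \<in> D k" for k x
    proof (intro exI conjI)
      show "\<sigma> k > 0" using \<sigma> that by blast
      have "norm (Q x - Q x0 - \<sigma> k *\<^sub>R w) = norm (Q x - Q (X (\<sigma> k)))"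
        unfolding X(2)[OF \<sigma>(2,3)[OF that(1)], symmetric] by simp
      also have "\<dots> \<le> L * norm (x - X (\<sigma> k))"
        using subsetD[OF Dsub[OF that(1)] that(2)] Xr[OF that(1)] by (rule lip)
      also have "\<dots> \<le> L * (\<rho> * \<theta>)"
        using that(2) L by (intro mult_left_mono) (auto simp: D_def dist_norm norm_minus_commute)
      also have "\<dots> = \<theta> * (s1 / 2)" using \<rho>(3) by (metis mult.assoc mult.commute)
      also have "\<dots> \<le> \<theta> * \<sigma> k" using \<theta>0 \<sigma>(1)[OF that(1)] by (intro mult_left_mono) auto
      finally show "norm (Q x - Q x0 - \<sigma> k *\<^sub>R w) \<le> \<theta> * \<sigma> k" .
    qed
    have disj: "disjnt (D i) (D j)" if ij: "i < j" "j < n" for i j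
    proof (rule ccontr)
      assume "\<not> disjnt (D i) (D j)"
      then obtain x where "x \<in> D i" "x \<in> D j" by (auto simp: disjnt_def)
      then have lt: "norm (X (\<sigma> j) - X (\<sigma> i)) < 2 * (\<rho> * \<theta>)"
        unfolding D_def dist_norm[symmetric] using dist_triangle[of "X (\<sigma> j)" "X (\<sigma> i)" x] by (simp add: dist_commute)
      have i: "i < n" using ij by simp
      have "(\<sigma> j - \<sigma> i) * norm w = norm ((\<sigma> j - \<sigma> i) *\<^sub>R w)"
        using ij s1 by (simp add: \<sigma>_def divide_right_mono mult_right_mono)
      also have "(\<sigma> j - \<sigma> i) *\<^sub>R w = Q (X (\<sigma> j)) - Q (X (\<sigma> i))"
        using X(2)[OF \<sigma>(2,3)[OF ij(2)]] X(2)[OF \<sigma>(2,3)[OF i]] by (simp add: algebra_simps)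
      also have "norm \<dots> \<le> L * norm (X (\<sigma> j) - X (\<sigma> i))" using Xr ij i by (intro lip)
      also have "\<dots> < L * (2 * (\<rho> * \<theta>))" using lt L by simp
      also have "\<dots> = s1 * \<theta>" using \<rho>(3) by (simp add: algebra_simps)
      \<comment> \<open>The choice of \<open>\<theta>\<close> makes the bound implied by an overlap
        equal to |w| times the spacing of the parameters, so overlapping balls would have parameters
        closer than the spacing.\<close>
      also have "s1 * \<theta> = s1 / (2 * real n) * norm w" using \<theta> by simp
      finally have "\<sigma> j - \<sigma> i < s1 / (2 * real n)"
        by (rule mult_right_less_imp_less) simp
      moreover have "(real i + 1) * (s1 / (2 * real n)) \<le> real j * (s1 / (2 * real n))"
        using ij s1 by (intro mult_right_mono) auto
      ultimately show False unfolding \<sigma>_def distrib_right mult_1 by linarith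
    qed
    have "measure lebesgue (\<Union>k<n. D k) = (\<Sum>k<n. measure lebesgue (D k))"
    proof (rule measure_UNION')
      show "pairwise (\<lambda>i j. disjnt (D i) (D j)) {..<n}"
        unfolding pairwise_def using disj by (metis disjnt_sym linorder_neqE_nat lessThan_iff)
    qed (auto simp: D_def)
    also have "\<dots> = real n * (unit_ball_vol (DIM('a)) * (\<rho> * \<theta>) ^ DIM('a))"
      using \<rho>\<theta>(2) unfolding D_def by (simp add: content_ball)
    finally have "measure lebesgue (\<Union>k<n. D k) = real n * (unit_ball_vol (DIM('a)) * (\<rho> * \<theta>) ^ DIM('a))" .
    moreover have "open (\<Union>k<n. D k)" "(\<Union>k<n. D k) \<subseteq> ball x0 r"
      using Dsub by (auto simp: D_def)
    ultimately show ?thesis using near by (intro exI[of _ "\<Union>k<n. D k"] conjI ballI) auto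
  qed
  then show ?thesis using \<rho>(1) by (intro exI[of _ \<rho>]) auto
qed

section \<open>Images of narrow cones under the subdifferential\<close>

lemma eventually_at_right_0_less: "0 < (b::real) \<Longrightarrow> \<forall>\<^sub>F r in at_right 0. r < b"
  by (rule eventually_at_right_0I)

text \<open>Since \<open>inner w \<eta> = inner (M \<eta>) \<nu>\<close>, the first order terms of
  the \<open>Q\<close> part and of the \<open>P\<close> part of \<open>f\<close> cancel. What
  remains at order \<open>s\<close> is the normal component of \<open>P y - P y0\<close>, and this
  is quadratically negative by \<open>strict\<close>. Before the local expansion may be used,
  \<open>far\<close> has to confine \<open>y\<close> to a fixed ball around
  \<open>y0\<close>.\<close>

lemma image_localization:
  fixes P Q M :: "'a::euclidean_space \<Rightarrow> 'a" and f :: "'a \<Rightarrow> 'a \<Rightarrow> real"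
  assumes M: "linear M" "inj M" and DQ: "(Q has_derivative adjoint M) (at x0)"
    and near: "\<And>e. e > 0 \<Longrightarrow> \<forall>\<^sub>F r in at_right 0. \<forall>x\<in>ball x0 r. \<forall>y\<in>ball y0 r.
      \<bar>f x y - inner (Q x - Q x0) (y - y0) - inner (P y - P y0 - M (y - y0)) (x - x0)\<bar>
        \<le> e * norm (x - x0) * (norm (y - y0))\<^sup>2"
    and quad: "C \<ge> 0" "\<forall>\<^sub>F r in at_right 0. \<forall>y\<in>ball y0 r. norm (P y - P y0 - M (y - y0)) \<le> C * (norm (y - y0))\<^sup>2"
    and far: "\<And>e. e > 0 \<Longrightarrow> \<forall>\<^sub>F r in at_right 0. \<forall>x\<in>ball x0 r. \<forall>y\<in>B.
      \<bar>f x y - inner (P y - P y0) (x - x0)\<bar> \<le> e * norm (x - x0)"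
    and B: "compact B" "y0 \<in> B" and P: "continuous_on B P" "inj_on P B"
    and \<nu>: "norm \<nu> = 1" and R: "R > 0"
    and strict: "\<And>y. y \<in> B \<Longrightarrow> (norm (P y - P y0))\<^sup>2 + 2 * R * inner (P y - P y0) \<nu> \<le> 0"
  defines "w \<equiv> adjoint M \<nu>"
  shows "\<exists>A>0. \<exists>\<theta>0>0. \<forall>\<^sub>F r in at_right 0. \<forall>x\<in>ball x0 r. \<forall>s>0. \<forall>\<theta>>0. \<theta> \<le> \<theta>0 \<longrightarrow>
    norm (Q x - Q x0 - s *\<^sub>R w) \<le> \<theta> * s \<longrightarrow>
    (\<forall>y\<in>B. f x y \<ge> 0 \<longrightarrow> norm (y - y0) \<le> A * \<theta> \<and> \<bar>inner w (y - y0)\<bar> \<le> A * \<theta>\<^sup>2)"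
proof -
  obtain m where m: "m > 0" "\<And>v. m * norm v \<le> norm (M v)"
    using linear_inj_bounded_below_pos[OF M] by blast
  have adj: "linear (adjoint M)" "inj (adjoint M)"
    using M adjoint_linear linear_injective_imp_surjective by auto
  obtain m' where m': "m' > 0" "\<And>v. m' * norm v \<le> norm (adjoint M v)"
    using linear_inj_bounded_below_pos[OF adj] by blast
  have strict': "inner (P y - P y0) \<nu> \<le> - ((norm (P y - P y0))\<^sup>2 / (2 * R))" if "y \<in> B" for y
    using strict[OF that] R by (simp add: field_simps)
  \<comment> \<open>Near \<open>y0\<close> the quadratic error is absorbed and |P y - P y0| \<ge>
    (m/2) |y - y0|; inserting this in \<open>strict'\<close> gives m^2/(8R).\<close>
  define \<kappa> where "\<kappa> = m\<^sup>2 / (8 * R)"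
  have \<kappa>: "\<kappa> > 0" using m R by (simp add: \<kappa>_def)
  obtain r0 where r0: "r0 > 0" "r0 < m / (2 * (C + 1))"
    "\<And>y. y \<in> ball y0 r0 \<Longrightarrow> norm (P y - P y0 - M (y - y0)) \<le> C * (norm (y - y0))\<^sup>2"
    "\<And>x y. x \<in> ball x0 r0 \<Longrightarrow> y \<in> ball y0 r0 \<Longrightarrow>
      \<bar>f x y - inner (Q x - Q x0) (y - y0) - inner (P y - P y0 - M (y - y0)) (x - x0)\<bar>
        \<le> \<kappa> / 8 * norm (x - x0) * (norm (y - y0))\<^sup>2"
  proof -
    have "\<kappa> / 8 > 0" "m / (2 * (C + 1)) > 0" using \<kappa> m quad(1) by simp_all
    from eventually_at_right_0D[OF eventually_conj[OF eventually_at_right_0_less[OF this(2)]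
        eventually_conj[OF quad(2) near[OF this(1)]]]]
    show ?thesis using that by blast
  qed
  have lower: "inner (P y - P y0) \<nu> \<le> - \<kappa> * (norm (y - y0))\<^sup>2" if y: "y \<in> B" "y \<in> ball y0 r0" for y
  proof -
    let ?\<eta> = "norm (y - y0)"
    have "C * ?\<eta> \<le> m / 2"
    proof -
      have "C * ?\<eta> \<le> (C + 1) * (m / (2 * (C + 1)))"
        using y(2) r0(2) quad(1) by (intro mult_mono) (auto simp: dist_norm norm_minus_commute)
      also have "\<dots> = m / 2" using quad(1) by (simp add: field_simps)
      finally show ?thesis .
    qed
    then have "C * ?\<eta> * ?\<eta> \<le> m / 2 * ?\<eta>" by (intro mult_right_mono) auto
    then have "C * ?\<eta>\<^sup>2 \<le> m / 2 * ?\<eta>" by (simp add: power2_eq_square)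
    then have "m / 2 * ?\<eta> \<le> norm (P y - P y0)"
      using r0(3)[OF y(2)] m(2)[of "y - y0"] norm_triangle_sub[of "M (y - y0)" "P y - P y0"]
      by (simp add: norm_minus_commute)
    then have "(m / 2 * ?\<eta>)\<^sup>2 \<le> (norm (P y - P y0))\<^sup>2" using m by (intro power_mono) auto
    then have "(m / 2 * ?\<eta>)\<^sup>2 / (2 * R) \<le> (norm (P y - P y0))\<^sup>2 / (2 * R)"
      using R by (intro divide_right_mono) auto
    also have "(m / 2 * ?\<eta>)\<^sup>2 / (2 * R) = \<kappa> * ?\<eta>\<^sup>2" by (simp add: \<kappa>_def power2_eq_square)
    finally show ?thesis using strict'[OF y(1)] by simp
  qed
  \<comment> \<open>Away from \<open>y0\<close>, injectivity of \<open>P\<close> makes the normal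
    component strictly negative, and compactness makes it uniformly so.\<close>
  obtain \<kappa>2 where \<kappa>2: "\<kappa>2 > 0" "\<And>y. y \<in> B \<Longrightarrow> y \<notin> ball y0 r0 \<Longrightarrow> inner (P y - P y0) \<nu> \<le> - \<kappa>2"
  proof (cases "B - ball y0 r0 = {}")
    case True
    show ?thesis by (rule that[of 1]) (use True in auto)
  next
    case False
    have "compact (B - ball y0 r0)" using B by (simp add: compact_diff)
    moreover have "continuous_on (B - ball y0 r0) (\<lambda>y. inner (P y - P y0) \<nu>)"
      by (intro continuous_intros continuous_on_subset[OF P(1)]) auto
    ultimately obtain y1 where y1: "y1 \<in> B - ball y0 r0"
      "\<And>y. y \<in> B - ball y0 r0 \<Longrightarrow> inner (P y - P y0) \<nu> \<le> inner (P y1 - P y0) \<nu>"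
      using continuous_attains_sup[OF _ False] by metis
    have "P y1 \<noteq> P y0" using y1(1) B(2) r0(1) inj_onD[OF P(2)] by force
    then have "(norm (P y1 - P y0))\<^sup>2 / (2 * R) > 0" using R by simp
    then show ?thesis using that[of "(norm (P y1 - P y0))\<^sup>2 / (2 * R)"] strict'[of y1] y1 by force
  qed
  have "bounded ((\<lambda>y. P y - P y0) ` B)"
    by (intro compact_imp_bounded compact_continuous_image B continuous_intros P)
  then obtain D where D: "D > 0" "\<And>y. y \<in> B \<Longrightarrow> norm (P y - P y0) \<le> D"
    unfolding bounded_pos by auto
  \<comment> \<open>\<open>e1\<close> bounds the relative deviation of x - x0 from the normal
    direction; it is chosen so that this deviation costs a quarter of \<open>\<kappa>\<close>
    locally and a quarter of \<open>\<kappa>2\<close> far away.\<close>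
  define e1 where "e1 = min 1 (min (\<kappa> / (4 * (C + 1))) (\<kappa>2 / (4 * D)))"
  have e1: "e1 > 0" "e1 \<le> 1" using \<kappa> \<kappa>2(1) D(1) quad(1) by (auto simp: e1_def)
  have Ce1: "C * e1 \<le> \<kappa> / 4"
  proof -
    have "C * e1 \<le> (C + 1) * (\<kappa> / (4 * (C + 1)))"
      using quad(1) e1(1) by (intro mult_mono) (auto simp: e1_def)
    also have "\<dots> = \<kappa> / 4" using quad(1) by (simp add: field_simps)
    finally show ?thesis .
  qed
  have De1: "D * e1 \<le> \<kappa>2 / 4"
  proof -
    have "D * e1 \<le> D * (\<kappa>2 / (4 * D))" using D(1) by (intro mult_left_mono) (auto simp: e1_def)
    then show ?thesis using D(1) by simp
  qed
  \<comment> \<open>One half of \<open>m'\<close> absorbs the term in \<open>norm \<sigma>\<close>;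
    the quarters allotted here and in \<open>\<theta>0\<close> add up to half of m' e1 s.\<close>
  define \<epsilon> where "\<epsilon> = min (m' / 2) (m' * e1 / 4)"
  have \<epsilon>: "\<epsilon> > 0" "\<epsilon> \<le> m' / 2" "\<epsilon> \<le> m' * e1 / 4" using m' e1 by (auto simp: \<epsilon>_def)
  define \<theta>0 where "\<theta>0 = m' * e1 / 4"
  have \<theta>0: "\<theta>0 > 0" using m' e1 by (simp add: \<theta>0_def)
  \<comment> \<open>Read off at the end: h \<le> (2/\<kappa>) \<theta> is inserted into \<theta> h +
    (\<kappa>/2 + C) h^2.\<close>
  define A where "A = 2 / \<kappa> + (\<kappa> / 2 + C) * (2 / \<kappa>)\<^sup>2"
  have A: "A > 0" "2 / \<kappa> \<le> A" using \<kappa> quad(1) by (auto simp: A_def intro!: add_pos_nonneg)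
  have dQ: "\<forall>\<^sub>F r in at_right 0. \<forall>x\<in>ball x0 r. norm (Q x - Q x0 - adjoint M (x - x0)) \<le> \<epsilon> * norm (x - x0)"
  proof -
    obtain d where d: "d > 0" "\<And>x. norm (x - x0) < d \<Longrightarrow> norm (Q x - Q x0 - adjoint M (x - x0)) \<le> \<epsilon> * norm (x - x0)"
      using DQ \<epsilon>(1) unfolding has_derivative_at_alt by blast
    show ?thesis by (rule eventually_at_right_0I[OF d(1)]) (auto intro!: d(2) simp: dist_norm norm_minus_commute)
  qed
  have "\<kappa>2 / 8 > 0" using \<kappa>2 by simp
  from eventually_at_right_0_less[OF r0(1)] far[OF this] dQ
  have "\<forall>\<^sub>F r in at_right 0. \<forall>x\<in>ball x0 r. \<forall>s>0. \<forall>\<theta>>0. \<theta> \<le> \<theta>0 \<longrightarrow>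
    norm (Q x - Q x0 - s *\<^sub>R w) \<le> \<theta> * s \<longrightarrow>
    (\<forall>y\<in>B. f x y \<ge> 0 \<longrightarrow> norm (y - y0) \<le> A * \<theta> \<and> \<bar>inner w (y - y0)\<bar> \<le> A * \<theta>\<^sup>2)"
  proof eventually_elim
    case (elim r)
    show ?case
    proof (intro ballI allI impI)
      fix x s \<theta> y
      assume x: "x \<in> ball x0 r" and s: "s > 0" and \<theta>: "\<theta> > 0" "\<theta> \<le> \<theta>0"
        and cone: "norm (Q x - Q x0 - s *\<^sub>R w) \<le> \<theta> * s" and y: "y \<in> B" and f: "0 \<le> f x y"
      define \<delta> where "\<delta> = x - x0"
      \<comment> \<open>As \<open>adjoint M\<close> sends \<open>\<nu>\<close> to \<open>w\<close>,
        a point of the curved cone is displaced from \<open>x0\<close> almost along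
        \<open>\<nu>\<close>, and \<open>\<sigma>\<close> is the error.\<close>
      define \<sigma> where "\<sigma> = \<delta> - s *\<^sub>R \<nu>"
      have \<delta>: "\<delta> = s *\<^sub>R \<nu> + \<sigma>" by (simp add: \<sigma>_def)
      have \<delta>le: "norm \<delta> \<le> s + norm \<sigma>"
        unfolding \<delta> using norm_triangle_ineq[of "s *\<^sub>R \<nu>" \<sigma>] s \<nu> by simp
      have "norm \<sigma> \<le> e1 * s"
      proof -
        interpret adj: linear "adjoint M" by (rule adj)
        have "adjoint M \<sigma> = (Q x - Q x0 - s *\<^sub>R w) - (Q x - Q x0 - adjoint M \<delta>)"
          unfolding \<sigma>_def w_def by (simp add: adj.diff adj.scale)
        then have "norm (adjoint M \<sigma>) \<le> norm (Q x - Q x0 - s *\<^sub>R w) + norm (Q x - Q x0 - adjoint M \<delta>)"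
          using norm_triangle_ineq4 by metis
        also have "\<dots> \<le> \<theta> * s + \<epsilon> * norm \<delta>"
          using cone bspec[OF elim(3) x] unfolding \<delta>_def by (intro add_mono)
        also have "\<epsilon> * norm \<delta> \<le> \<epsilon> * (s + norm \<sigma>)" using \<delta>le \<epsilon>(1) by (intro mult_left_mono) auto
        finally have "norm (adjoint M \<sigma>) \<le> \<theta> * s + \<epsilon> * s + \<epsilon> * norm \<sigma>" by (simp add: algebra_simps)
        moreover have "\<theta> * s \<le> m' * e1 / 4 * s" "\<epsilon> * s \<le> m' * e1 / 4 * s" "\<epsilon> * norm \<sigma> \<le> m' / 2 * norm \<sigma>"
          using \<theta> \<epsilon> s unfolding \<theta>0_def by (auto intro!: mult_right_mono simp del: times_divide_eq_left)
        ultimately have "m' / 2 * norm \<sigma> \<le> m' / 2 * (e1 * s)" using m'(2)[of \<sigma>] by argo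
        then show ?thesis using m'(1) by simp
      qed
      moreover have "e1 * s \<le> s" using e1 s by simp
      ultimately have \<sigma>: "norm \<sigma> \<le> e1 * s" "norm \<delta> \<le> 2 * s" using \<delta>le by auto
      have inball: "y \<in> ball y0 r0"
      proof (rule ccontr)
        assume "y \<notin> ball y0 r0"
        then have "inner (P y - P y0) \<nu> \<le> - \<kappa>2" using \<kappa>2 y by blast
        then have "s * inner (P y - P y0) \<nu> \<le> s * (- \<kappa>2)" using s by (intro mult_left_mono) auto
        moreover have "inner (P y - P y0) \<sigma> \<le> D * (e1 * s)"
          using norm_cauchy_schwarz[of "P y - P y0" \<sigma>] mult_mono[OF D(2)[OF y] \<sigma>(1)] D(1) by simp
        moreover have "D * e1 * s \<le> \<kappa>2 / 4 * s" using De1 s by (intro mult_right_mono) auto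
        moreover have "f x y \<le> inner (P y - P y0) \<delta> + \<kappa>2 / 8 * norm \<delta>"
          using bspec[OF bspec[OF elim(2) x] y] unfolding \<delta>_def by linarith
        moreover have "inner (P y - P y0) \<delta> = s * inner (P y - P y0) \<nu> + inner (P y - P y0) \<sigma>"
          unfolding \<delta> by (simp add: inner_right_distrib)
        moreover have "\<kappa>2 / 8 * norm \<delta> \<le> \<kappa>2 / 8 * (2 * s)" using \<sigma>(2) \<kappa>2 by (intro mult_left_mono) auto
        ultimately have "f x y \<le> - (\<kappa>2 * s) / 2" by argo
        then show False using f mult_pos_pos[OF \<kappa>2(1) s] by simp
      qed
      define \<eta> where "\<eta> = y - y0"
      define h where "h = norm \<eta>"
      have h: "h \<ge> 0" by (simp add: h_def)
      let ?\<pi> = "P y - P y0"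
      have q: "norm (?\<pi> - M \<eta>) \<le> C * h\<^sup>2" using r0(3)[OF inball] by (simp add: \<eta>_def h_def)
      have w\<eta>: "inner w \<eta> = inner (M \<eta>) \<nu>"
        unfolding w_def using adjoint_works[OF M(1), of \<eta> \<nu>] by (simp add: inner_commute)
      have "x \<in> ball x0 r0" using x elim(1) by simp
      from r0(4)[OF this inball]
      have "\<bar>f x y - inner (Q x - Q x0) \<eta> - inner (?\<pi> - M \<eta>) \<delta>\<bar> \<le> \<kappa> / 8 * norm \<delta> * h\<^sup>2"
        unfolding \<eta>_def \<delta>_def h_def .
      then have "f x y \<le> inner (Q x - Q x0) \<eta> + inner (?\<pi> - M \<eta>) \<delta> + \<kappa> / 8 * norm \<delta> * h\<^sup>2"
        by linarith
      moreover have "inner (Q x - Q x0) \<eta> \<le> s * inner w \<eta> + \<theta> * s * h"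
      proof -
        have "inner (Q x - Q x0) \<eta> = s * inner w \<eta> + inner (Q x - Q x0 - s *\<^sub>R w) \<eta>"
          by (simp add: inner_diff_left)
        also have "inner (Q x - Q x0 - s *\<^sub>R w) \<eta> \<le> \<theta> * s * h"
          unfolding h_def by (rule order.trans[OF norm_cauchy_schwarz mult_right_mono[OF cone]]) simp
        finally show ?thesis by simp
      qed
      moreover have "inner (?\<pi> - M \<eta>) \<delta> \<le> s * inner ?\<pi> \<nu> - s * inner w \<eta> + \<kappa> / 4 * s * h\<^sup>2"
      proof -
        have "inner (?\<pi> - M \<eta>) \<delta> = s * inner ?\<pi> \<nu> - s * inner w \<eta> + inner (?\<pi> - M \<eta>) \<sigma>"
          unfolding \<delta> w\<eta> by (simp add: inner_right_distrib inner_diff_left algebra_simps)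
        moreover have "inner (?\<pi> - M \<eta>) \<sigma> \<le> C * h\<^sup>2 * (e1 * s)"
          using norm_cauchy_schwarz[of "?\<pi> - M \<eta>" \<sigma>] mult_mono[OF q \<sigma>(1)] quad(1) by simp
        moreover have "C * e1 * (s * h\<^sup>2) \<le> \<kappa> / 4 * (s * h\<^sup>2)" using Ce1 s by (intro mult_right_mono) auto
        ultimately show ?thesis by (simp add: mult_ac)
      qed
      moreover have "\<kappa> / 8 * norm \<delta> * h\<^sup>2 \<le> \<kappa> / 8 * (2 * s) * h\<^sup>2"
        using \<sigma>(2) \<kappa> by (intro mult_right_mono mult_left_mono) auto
      \<comment> \<open>The two terms with \<open>inner w \<eta>\<close> have cancelled, and each of
        the two quadratic errors has used a quarter of \<open>\<kappa>\<close>; the other half of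
        \<open>\<kappa>\<close> will force \<open>h\<close> to be of order
        \<open>\<theta>\<close>.\<close>
      ultimately have "0 \<le> s * (inner ?\<pi> \<nu> + \<theta> * h + \<kappa> / 2 * h\<^sup>2)"
        using f by (simp add: algebra_simps)
      then have main: "- inner ?\<pi> \<nu> \<le> \<theta> * h + \<kappa> / 2 * h\<^sup>2" using s by (simp add: zero_le_mult_iff)
      moreover have low: "\<kappa> * h\<^sup>2 \<le> - inner ?\<pi> \<nu>" using lower[OF y inball] by (simp add: h_def \<eta>_def)
      ultimately have "\<kappa> / 2 * h * h \<le> \<theta> * h" by (simp add: power2_eq_square)
      then have h\<theta>: "h \<le> 2 / \<kappa> * \<theta>"
        using h \<kappa> \<theta> by (cases "h = 0") (simp_all add: field_simps)
      have "\<bar>inner w \<eta>\<bar> \<le> \<theta> * h + (\<kappa> / 2 + C) * h\<^sup>2"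
      proof -
        have "\<bar>inner (?\<pi> - M \<eta>) \<nu>\<bar> \<le> C * h\<^sup>2"
          using Cauchy_Schwarz_ineq2[of "?\<pi> - M \<eta>" \<nu>] q \<nu> by simp
        moreover have "\<kappa> * h\<^sup>2 \<ge> 0" using \<kappa> by simp
        ultimately have "\<bar>inner (M \<eta>) \<nu>\<bar> \<le> - inner ?\<pi> \<nu> + C * h\<^sup>2"
          using low unfolding inner_diff_left[of ?\<pi>] by linarith
        then show ?thesis using main unfolding w\<eta> by (simp add: algebra_simps)
      qed
      also have "\<dots> \<le> \<theta> * (2 / \<kappa> * \<theta>) + (\<kappa> / 2 + C) * (2 / \<kappa> * \<theta>)\<^sup>2"
        using h\<theta> h \<theta> \<kappa> quad(1) by (intro add_mono mult_left_mono power_mono) auto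
      also have "\<dots> = A * \<theta>\<^sup>2" by (simp add: A_def power2_eq_square algebra_simps)
      finally have "\<bar>inner w \<eta>\<bar> \<le> A * \<theta>\<^sup>2" .
      moreover have "h \<le> A * \<theta>" using h\<theta> mult_right_mono[OF A(2), of \<theta>] \<theta> by linarith
      ultimately show "norm (y - y0) \<le> A * \<theta> \<and> \<bar>inner w (y - y0)\<bar> \<le> A * \<theta>\<^sup>2"
        by (simp add: h_def \<eta>_def)
    qed
  qed
  then show ?thesis using A(1) \<theta>0 by blast
qed

section \<open>From strong convexity to the comparison of measures\<close>

text \<open>Squaring the membership in the supporting ball gives the inequality, and being closed in
  \<open>p\<close> it passes to the closure. The normal comes from separating \<open>p0\<close> from
  the convex set.\<close>

lemma strongly_convex_supporting_ball:
  fixes W :: "'a::euclidean_space set"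
  assumes W: "strongly_convex W" "W \<noteq> {}" and p0: "p0 \<in> closure W" "p0 \<notin> W"
  shows "\<exists>\<nu> R. norm \<nu> = 1 \<and> R > 0 \<and>
    (\<forall>p\<in>closure W. (norm (p - p0))\<^sup>2 + 2 * R * inner (p - p0) \<nu> \<le> 0)"
proof -
  obtain a b where ab: "a \<noteq> 0" "\<And>p. p \<in> W \<Longrightarrow> inner a p \<le> b" "b \<le> inner a p0"
  proof -
    have "\<exists>a b. a \<noteq> 0 \<and> (\<forall>x\<in>W. inner a x \<le> b) \<and> (\<forall>x\<in>{p0}. b \<le> inner a x)"
      using W p0(2) unfolding strongly_convex_def by (intro separating_hyperplane_sets) auto
    then show ?thesis using that by blast
  qed
  define \<nu> where "\<nu> = a /\<^sub>R norm a"
  have \<nu>: "norm \<nu> = 1" using ab(1) by (simp add: \<nu>_def)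
  have supp: "inner (p - p0) \<nu> \<le> 0" if "p \<in> W" for p
  proof -
    have "inner (p - p0) a \<le> 0"
      using ab(2)[OF that] ab(3) by (simp add: inner_commute[of _ a] inner_diff_right)
    then show ?thesis by (simp add: \<nu>_def mult_nonneg_nonpos)
  qed
  have "p0 \<in> frontier W" using p0 interior_subset by (auto simp: frontier_def)
  then obtain R where R: "W \<subseteq> cball (p0 - R *\<^sub>R \<nu>) R"
    using W(1) \<nu> supp unfolding strongly_convex_def by blast
  have "R \<ge> 0"
  proof -
    obtain p where "p \<in> cball (p0 - R *\<^sub>R \<nu>) R" using R W(2) by blast
    then show ?thesis using zero_le_dist[of "p0 - R *\<^sub>R \<nu>" p] by (simp del: zero_le_dist)
  qed
  \<comment> \<open>The definition yields only a radius R \<ge> 0; enlarging it to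
    \<open>R + 1\<close> makes it positive and preserves the inequality, since
    \<open>inner (p - p0) \<nu>\<close> is nonpositive.\<close>
  have "(norm (p - p0))\<^sup>2 + 2 * (R + 1) * inner (p - p0) \<nu> \<le> 0" if p: "p \<in> W" for p
  proof -
    have "norm ((p - p0) + R *\<^sub>R \<nu>) \<le> R"
      using subsetD[OF R p] by (simp add: dist_norm norm_minus_commute algebra_simps)
    then have "(norm ((p - p0) + R *\<^sub>R \<nu>))\<^sup>2 \<le> R\<^sup>2" by (intro power_mono) auto
    moreover have "(norm ((p - p0) + R *\<^sub>R \<nu>))\<^sup>2 = (norm (p - p0))\<^sup>2 + 2 * R * inner (p - p0) \<nu> + R\<^sup>2 * (norm \<nu>)\<^sup>2"
      unfolding power2_norm_eq_inner by (simp add: inner_simps inner_commute power2_eq_square algebra_simps)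
    ultimately show ?thesis using supp[OF p] \<nu> by (simp add: algebra_simps)
  qed
  then have "W \<subseteq> {p. (norm (p - p0))\<^sup>2 + 2 * (R + 1) * inner (p - p0) \<nu> \<le> 0}" by auto
  moreover have "closed {p. (norm (p - p0))\<^sup>2 + 2 * (R + 1) * inner (p - p0) \<nu> \<le> 0}"
    by (intro closed_Collect_le continuous_intros)
  ultimately have "closure W \<subseteq> {p. (norm (p - p0))\<^sup>2 + 2 * (R + 1) * inner (p - p0) \<nu> \<le> 0}"
    by (rule closure_minimal)
  then show ?thesis using \<nu> \<open>R \<ge> 0\<close> by (intro exI[of _ \<nu>] exI[of _ "R + 1"]) auto
qed

lemma diffeo_onto_rangeD:
  assumes "diffeo_onto_range P S"
  shows "inj_on P S" "continuous_on S P"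
    "y \<in> S \<Longrightarrow> (P has_derivative M) (at y) \<Longrightarrow> inj M"
proof -
  show "inj_on P S" using assms by (simp add: diffeo_onto_range_def)
  show "continuous_on S P"
    using assms has_derivative_continuous unfolding diffeo_onto_range_def
    by (intro continuous_at_imp_continuous_on) blast
  assume y: "y \<in> S" and M: "(P has_derivative M) (at y)"
  obtain f' g' where f: "(P has_derivative f') (at y)" "g' \<circ> f' = id"
    using assms y unfolding diffeo_onto_range_def by blast
  have "M = f'" using M f(1) by (rule has_derivative_unique)
  then show "inj M" using f(2) by (metis inj_on_id inj_on_imageI2)
qed

text \<open>The function \<open>u\<close> is absent: its only trace is the monotonicity inequality
  in the conclusion. That inequality keeps its form when the two variables are exchanged, so this
  one estimate serves (a) and, with the exchanged cost, (b).\<close>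

lemma small_image_of_large_set:
  fixes c :: "'a::euclidean_space \<Rightarrow> 'a \<Rightarrow> real" and V :: "'a set"
  assumes N: "open N" "{x0} \<times> closure V \<subseteq> N" and c: "Ck_on 3 N (case_prod c)"
    and V: "open V" "bounded V" and y0: "y0 \<in> frontier V"
    and diffeo: "diffeo_onto_range (\<lambda>y. - Dx c x0 y) (closure V)"
    and conv: "strongly_convex ((\<lambda>y. - Dx c x0 y) ` V)"
    and k: "k > 0" and d: "d > 0"
  shows "\<exists>E S. open E \<and> E \<subseteq> ball x0 d \<and> compact S \<and> measure lebesgue S < k * measure lebesgue E \<and>
    (\<forall>x\<in>E. \<forall>y\<in>closure V. c x y + c x0 y0 \<le> c x0 y + c x y0 \<longrightarrow> y \<in> S)"
proof -
  define P where "P = (\<lambda>y. - Dx c x0 y)"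
  define Q where "Q = (\<lambda>x. - Dy c x y0)"
  define f where "f = (\<lambda>x y. c x0 y + c x y0 - c x y - c x0 y0)"
  let ?B = "closure V"
  have B: "compact ?B" "y0 \<in> ?B" "y0 \<notin> V"
    using V y0 by (auto simp: frontier_def interior_open)
  have zN: "(x0, y0) \<in> N" using N(2) B(2) by auto
  have c1: "Ck_on 1 N (case_prod c)" using c by (rule Ck_on_le) simp
  note dP = diffeo_onto_rangeD[OF diffeo, folded P_def]
  have "\<exists>M. linear M \<and> (P has_derivative M) (at y0) \<and> (Q has_derivative adjoint M) (at x0) \<and>
    (\<forall>e>0. \<forall>\<^sub>F r in at_right 0. \<forall>x\<in>ball x0 r. \<forall>y\<in>ball y0 r.
      \<bar>f x y - inner (Q x - Q x0) (y - y0) - inner (P y - P y0 - M (y - y0)) (x - x0)\<bar>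
        \<le> e * norm (x - x0) * (norm (y - y0))\<^sup>2) \<and>
    (\<exists>C\<ge>0. \<forall>\<^sub>F r in at_right 0. \<forall>y\<in>ball y0 r. norm (P y - P y0 - M (y - y0)) \<le> C * (norm (y - y0))\<^sup>2) \<and>
    (\<exists>L\<ge>0. \<forall>\<^sub>F r in at_right 0. \<forall>x\<in>ball x0 r. \<forall>x'\<in>ball x0 r. norm (Q x - Q x') \<le> L * norm (x - x'))"
    unfolding P_def Q_def f_def by (rule cost_expansion[OF N(1) zN c])
  then obtain M C L where M: "linear M" "(P has_derivative M) (at y0)" "(Q has_derivative adjoint M) (at x0)"
    and near: "\<And>e. e > 0 \<Longrightarrow> \<forall>\<^sub>F r in at_right 0. \<forall>x\<in>ball x0 r. \<forall>y\<in>ball y0 r.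
      \<bar>f x y - inner (Q x - Q x0) (y - y0) - inner (P y - P y0 - M (y - y0)) (x - x0)\<bar>
        \<le> e * norm (x - x0) * (norm (y - y0))\<^sup>2"
    and C: "C \<ge> 0" "\<forall>\<^sub>F r in at_right 0. \<forall>y\<in>ball y0 r. norm (P y - P y0 - M (y - y0)) \<le> C * (norm (y - y0))\<^sup>2"
    and L: "L \<ge> 0" "\<forall>\<^sub>F r in at_right 0. \<forall>x\<in>ball x0 r. \<forall>x'\<in>ball x0 r. norm (Q x - Q x') \<le> L * norm (x - x')"
    by (elim exE conjE) (rule that; simp)
  have far: "\<forall>\<^sub>F r in at_right 0. \<forall>x\<in>ball x0 r. \<forall>y\<in>?B. \<bar>f x y - inner (P y - P y0) (x - x0)\<bar> \<le> e * norm (x - x0)"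
    if "e > 0" for e
    unfolding P_def f_def by (rule cost_expansion_uniform[OF N B(1,2) c1 that])
  have injM: "inj M" using dP(3)[OF B(2) M(2)] .
  have bijM: "bij (adjoint M)"
    using injM M(1) linear_injective_imp_surjective by (auto simp: bij_def)
  have sub: "P ` ?B \<subseteq> closure (P ` V)"
    using dP(2) by (rule image_closure_subset) (auto simp: closure_subset)
  have "P y0 \<notin> P ` V" using inj_onD[OF dP(1) _ B(2)] B(3) closure_subset[of V] by blast
  moreover have "P ` V \<noteq> {}" using y0 by auto
  ultimately obtain \<nu> R where \<nu>: "norm \<nu> = 1" and R: "R > 0"
    and strict: "\<And>p. p \<in> closure (P ` V) \<Longrightarrow> (norm (p - P y0))\<^sup>2 + 2 * R * inner (p - P y0) \<nu> \<le> 0"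
    using strongly_convex_supporting_ball[of "P ` V" "P y0"] conv sub B(2) unfolding P_def by blast
  define w where "w = adjoint M \<nu>"
  have w: "w \<noteq> 0"
  proof
    assume "w = 0"
    then have "adjoint M \<nu> = adjoint M 0" using linear_0[OF adjoint_linear[OF M(1)]] by (simp add: w_def)
    then have "\<nu> = 0" using bijM by (simp add: bij_def inj_eq)
    then show False using \<nu> by simp
  qed
  have "\<exists>A>0. \<exists>\<theta>0>0. \<forall>\<^sub>F r in at_right 0. \<forall>x\<in>ball x0 r. \<forall>s>0. \<forall>\<theta>>0. \<theta> \<le> \<theta>0 \<longrightarrow>
    norm (Q x - Q x0 - s *\<^sub>R w) \<le> \<theta> * s \<longrightarrow>
    (\<forall>y\<in>?B. f x y \<ge> 0 \<longrightarrow> norm (y - y0) \<le> A * \<theta> \<and> \<bar>inner w (y - y0)\<bar> \<le> A * \<theta>\<^sup>2)"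
    unfolding w_def
    by (rule image_localization[OF M(1) injM M(3) near C far B(1,2) dP(2,1) \<nu> R strict])
      (use sub in auto)
  then obtain A \<theta>0 where A: "A > 0" and \<theta>0: "\<theta>0 > 0"
    and loc: "\<forall>\<^sub>F r in at_right 0. \<forall>x\<in>ball x0 r. \<forall>s>0. \<forall>\<theta>>0. \<theta> \<le> \<theta>0 \<longrightarrow>
    norm (Q x - Q x0 - s *\<^sub>R w) \<le> \<theta> * s \<longrightarrow>
    (\<forall>y\<in>?B. f x y \<ge> 0 \<longrightarrow> norm (y - y0) \<le> A * \<theta> \<and> \<bar>inner w (y - y0)\<bar> \<le> A * \<theta>\<^sup>2)"
    by (elim exE conjE) (rule that)
  obtain r where r: "r > 0" "r < d"
    and lip: "\<And>x x'. x \<in> ball x0 r \<Longrightarrow> x' \<in> ball x0 r \<Longrightarrow> norm (Q x - Q x') \<le> L * norm (x - x')"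
    and locr: "\<And>x s \<theta> y. x \<in> ball x0 r \<Longrightarrow> s > 0 \<Longrightarrow> \<theta> > 0 \<Longrightarrow> \<theta> \<le> \<theta>0 \<Longrightarrow>
      norm (Q x - Q x0 - s *\<^sub>R w) \<le> \<theta> * s \<Longrightarrow> y \<in> ?B \<Longrightarrow> f x y \<ge> 0 \<Longrightarrow>
      norm (y - y0) \<le> A * \<theta> \<and> \<bar>inner w (y - y0)\<bar> \<le> A * \<theta>\<^sup>2"
    using eventually_at_right_0D[OF eventually_conj[OF eventually_at_right_0_less[OF d] eventually_conj[OF L(2) loc]]]
    by (elim exE conjE) (rule that; blast)
  have lip': "norm (Q x - Q x') \<le> (L + 1) * norm (x - x')" if "x \<in> ball x0 r" "x' \<in> ball x0 r" for x x'
    using lip[OF that] norm_ge_zero[of "x - x'"] unfolding distrib_right by linarith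
  have L1: "L + 1 > 0" using L(1) by simp
  obtain \<rho> where \<rho>: "\<rho> > 0" and cone: "\<And>n. n > 0 \<Longrightarrow> norm w / (2 * real n) \<le> 1 \<Longrightarrow> \<exists>E. open E \<and> E \<subseteq> ball x0 r \<and>
      measure lebesgue E = real n * (unit_ball_vol (DIM('a)) * (\<rho> * (norm w / (2 * real n))) ^ DIM('a)) \<and>
      (\<forall>x\<in>E. \<exists>s>0. norm (Q x - Q x0 - s *\<^sub>R w) \<le> norm w / (2 * real n) * s)"
    using curved_cone_lower_bound[OF r(1) L1 lip' M(3) bijM w] by blast
  let ?D = "DIM('a)"
  \<comment> \<open>The first two bounds give \<theta> \<le> 1 and \<theta> \<le> \<theta>0, the
    third decides the comparison of measures, and the final 1 ensures n \<ge> 1.\<close>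
  obtain n :: nat where n: "real n > max (max (norm w) (norm w / \<theta>0)) ((5 / 2 * A) ^ ?D / (k * \<rho> ^ ?D)) + 1"
    using reals_Archimedean2 by blast
  then have n1: "real n \<ge> 1" "norm w \<le> real n" "norm w / \<theta>0 \<le> real n" "(5 / 2 * A) ^ ?D / (k * \<rho> ^ ?D) < real n"
    by (auto simp: max_def split: if_splits) (use norm_ge_zero[of w] in linarith)+
  define \<theta> where "\<theta> = norm w / (2 * real n)"
  have \<theta>: "\<theta> > 0" "\<theta> \<le> 1" "\<theta> \<le> \<theta>0"
  proof -
    show "\<theta> > 0" "\<theta> \<le> 1" using w n1(1,2) by (simp_all add: \<theta>_def)
    have "norm w \<le> real n * \<theta>0" using n1(3) \<theta>0 by (simp add: pos_divide_le_eq)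
    also have "\<dots> \<le> \<theta>0 * (2 * real n)" using \<theta>0 by simp
    finally show "\<theta> \<le> \<theta>0" unfolding \<theta>_def using n1(1) by (simp add: pos_divide_le_eq)
  qed
  obtain E where E: "open E" "E \<subseteq> ball x0 r" "measure lebesgue E = real n * (unit_ball_vol ?D * (\<rho> * \<theta>) ^ ?D)"
    "\<And>x. x \<in> E \<Longrightarrow> \<exists>s>0. norm (Q x - Q x0 - s *\<^sub>R w) \<le> \<theta> * s"
    using cone[of n] n1(1) \<theta>(2) unfolding \<theta>_def[symmetric] by auto
  define S where "S = {y. norm (y - y0) \<le> A * \<theta> \<and> \<bar>inner w (y - y0)\<bar> \<le> A * \<theta>\<^sup>2}"
  have S: "compact S" "real n * measure lebesgue S \<le> unit_ball_vol ?D * (5 / 2 * A * \<theta>) ^ ?D"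
    using measure_slab_le[OF w A, of n y0] n1(1) unfolding \<theta>_def[symmetric] S_def[symmetric] by auto
  have "real n * measure lebesgue S < real n * (k * measure lebesgue E)"
  proof -
    have "(5 / 2 * A) ^ ?D < real n * (k * \<rho> ^ ?D)"
      using n1(4) k \<rho> by (simp add: field_simps)
    \<comment> \<open>One factor \<open>n\<close> comes from the number of balls in the cone, the
      other from the number of slab translates.\<close>
    also have "\<dots> \<le> real n * (real n * (k * \<rho> ^ ?D))"
      using n1(1) k \<rho> mult_right_mono[OF n1(1), of "k * \<rho> ^ ?D"] by (intro mult_left_mono) simp_all
    finally have lt: "(unit_ball_vol ?D * \<theta> ^ ?D) * (5 / 2 * A) ^ ?D
        < (unit_ball_vol ?D * \<theta> ^ ?D) * (real n * (real n * (k * \<rho> ^ ?D)))"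
      using \<theta>(1) by (intro mult_strict_left_mono) auto
    have "real n * measure lebesgue S \<le> (unit_ball_vol ?D * \<theta> ^ ?D) * (5 / 2 * A) ^ ?D"
      using S(2) by (simp only: power_mult_distrib mult_ac)
    also note lt
    also have "(unit_ball_vol ?D * \<theta> ^ ?D) * (real n * (real n * (k * \<rho> ^ ?D))) = real n * (k * measure lebesgue E)"
      unfolding E(3) by (simp only: power_mult_distrib mult_ac)
    finally show ?thesis .
  qed
  then have "measure lebesgue S < k * measure lebesgue E" using n1(1) by simp
  moreover have "y \<in> S" if xy: "x \<in> E" "y \<in> ?B" "c x y + c x0 y0 \<le> c x0 y + c x y0" for x y
  proof -
    obtain s where s: "s > 0" "norm (Q x - Q x0 - s *\<^sub>R w) \<le> \<theta> * s" using E(4)[OF xy(1)] by blast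
    have "f x y \<ge> 0" using xy(3) by (simp add: f_def)
    then show ?thesis
      unfolding S_def using locr[OF subsetD[OF E(2) xy(1)] s(1) \<theta>(1,3) s(2) xy(2)] by simp
  qed
  moreover have "E \<subseteq> ball x0 d" using E(2) r(2) by auto
  ultimately show ?thesis using E(1) S(1) by (intro exI[of _ E] exI[of _ S]) blast
qed

section \<open>Compactness of the subdifferential\<close>

text \<open>\<open>u\<close> is a supremum of functions of \<open>x\<close> whose increments are
  those of the cost, hence share its modulus of uniform continuity; the supremum inherits that
  modulus.\<close>

lemma c_convex_continuous_on:
  assumes K: "compact (closure U)" "compact (closure V)" and V: "closure V \<noteq> {}"
    and c: "continuous_on (closure U \<times> closure V) (case_prod c)" and u: "c_convex c U V u"
  shows "continuous_on (closure U) u"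
proof -
  let ?v = "c_star_transform c U u"
  have uc: "uniformly_continuous_on (closure U \<times> closure V) (case_prod c)"
    by (intro compact_uniformly_continuous c compact_Times K)
  have u_eq: "u x = (SUP y\<in>closure V. - c x y - ?v y)"
    and bdd: "bdd_above ((\<lambda>y. - c x y - ?v y) ` closure V)" if "x \<in> closure U" for x
    using u that unfolding c_convex_def c_transform_def by auto
  have le: "u x \<le> u x' + e"
    if x: "x \<in> closure U" "x' \<in> closure U" and e: "\<And>y. y \<in> closure V \<Longrightarrow> \<bar>c x y - c x' y\<bar> \<le> e" for x x' e
    unfolding u_eq[OF x(1)]
  proof (rule cSUP_least[OF V])
    fix y assume y: "y \<in> closure V"
    have "- c x' y - ?v y \<le> u x'"
      unfolding u_eq[OF x(2)] by (rule cSUP_upper[OF y bdd[OF x(2)]])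
    then show "- c x y - ?v y \<le> u x' + e" using e[OF y] by linarith
  qed
  show ?thesis
    unfolding continuous_on_iff
  proof (intro ballI allI impI)
    fix x and e :: real assume x: "x \<in> closure U" and e: "e > 0"
    then have "e / 2 > 0" by simp
    then obtain d where d: "d > 0" "\<And>p p'. p \<in> closure U \<times> closure V \<Longrightarrow> p' \<in> closure U \<times> closure V \<Longrightarrow>
        dist p' p < d \<Longrightarrow> dist (case_prod c p') (case_prod c p) < e / 2"
      using uc unfolding uniformly_continuous_on_def by metis
    have "dist (u x') (u x) < e" if x': "x' \<in> closure U" "dist x' x < d" for x'
    proof -
      have "\<bar>c x' y - c x y\<bar> \<le> e / 2" if "y \<in> closure V" for y
        using d(2)[of "(x, y)" "(x', y)"] x x' that by (simp add: dist_Pair_Pair dist_real_def)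
      then have "u x' \<le> u x + e / 2" "u x \<le> u x' + e / 2"
        by (intro le x x'(1); simp add: abs_minus_commute[of "c x _"])+
      then show ?thesis using e by (simp add: dist_real_def abs_if)
    qed
    then show "\<exists>d>0. \<forall>x'\<in>closure U. dist x' x < d \<longrightarrow> dist (u x') (u x) < e"
      using d(1) by blast
  qed
qed

text \<open>Equality in the definition says that the supremum defining the transform is attained at
  \<open>x\<close>. Boundedness is what gives the real-valued \<open>SUP\<close> its meaning as a
  least upper bound. In this form the relation is a family of closed conditions, and two instances
  added together eliminate \<open>u\<close>.\<close>

lemma c_subdiff_iff:
  assumes "\<forall>y\<in>closure V. bdd_above ((\<lambda>x. - c x y - u x) ` closure U)"
  shows "(x, y) \<in> c_subdiff c U V u \<longleftrightarrow> x \<in> closure U \<and> y \<in> closure V \<and>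
    (\<forall>x'\<in>closure U. u x + c x y \<le> u x' + c x' y)"
proof (cases "x \<in> closure U \<and> y \<in> closure V")
  case True
  have up: "- c x' y - u x' \<le> c_star_transform c U u y" if "x' \<in> closure U" for x'
    unfolding c_star_transform_def using True by (intro cSUP_upper[OF that] bspec[OF assms]) simp
  have "u x + c_star_transform c U u y + c x y = 0 \<longleftrightarrow> (\<forall>x'\<in>closure U. u x + c x y \<le> u x' + c x' y)"
  proof
    assume "u x + c_star_transform c U u y + c x y = 0"
    then show "\<forall>x'\<in>closure U. u x + c x y \<le> u x' + c x' y" using up by fastforce
  next
    assume *: "\<forall>x'\<in>closure U. u x + c x y \<le> u x' + c x' y"
    have "c_star_transform c U u y \<le> - c x y - u x"
      unfolding c_star_transform_def
    proof (rule cSUP_least)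
      show "closure U \<noteq> {}" using True by auto
      show "- c x' y - u x' \<le> - c x y - u x" if "x' \<in> closure U" for x'
        using *[rule_format, OF that] by linarith
    qed
    then show "u x + c_star_transform c U u y + c x y = 0" using up[of x] True by linarith
  qed
  then show ?thesis using True by (simp add: c_subdiff_def)
qed (auto simp: c_subdiff_def)

lemma compact_c_subdiff:
  assumes K: "compact (closure U)" "compact (closure V)"
    and c: "continuous_on (closure U \<times> closure V) (case_prod c)" and u: "continuous_on (closure U) u"
    and bdd: "\<forall>y\<in>closure V. bdd_above ((\<lambda>x. - c x y - u x) ` closure U)"
  shows "compact (c_subdiff c U V u)"
proof -
  let ?K = "closure U \<times> closure V"
  have cK: "compact ?K" by (intro compact_Times K)
  have c': "continuous_on ?K (\<lambda>p. c (fst p) (snd p))" using c by (simp add: case_prod_beta')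
  have u': "continuous_on ?K (\<lambda>p. u (fst p))"
    by (rule continuous_on_compose2[OF u]) (auto intro!: continuous_intros)
  have "closed {p \<in> ?K. u (fst p) + c (fst p) (snd p) \<le> u x' + c x' (snd p)}" if "x' \<in> closure U" for x'
  proof (rule continuous_on_closed_Collect_le)
    have "continuous_on ?K (\<lambda>p. case_prod c (x', snd p))"
      by (rule continuous_on_compose2[OF c]) (use that in \<open>auto intro!: continuous_intros\<close>)
    then show "continuous_on ?K (\<lambda>p. u x' + c x' (snd p))" by (simp add: continuous_intros)
    show "continuous_on ?K (\<lambda>p. u (fst p) + c (fst p) (snd p))" by (intro continuous_intros u' c')
    show "closed ?K" using cK by (rule compact_imp_closed)
  qed
  then have "closed (\<Inter>x'\<in>closure U. {p \<in> ?K. u (fst p) + c (fst p) (snd p) \<le> u x' + c x' (snd p)})"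
    by (intro closed_INT) blast
  then have "compact (?K \<inter> (\<Inter>x'\<in>closure U. {p \<in> ?K. u (fst p) + c (fst p) (snd p) \<le> u x' + c x' (snd p)}))"
    by (rule compact_Int_closed[OF cK])
  also have "?K \<inter> (\<Inter>x'\<in>closure U. {p \<in> ?K. u (fst p) + c (fst p) (snd p) \<le> u x' + c x' (snd p)})
    = c_subdiff c U V u"
  proof (intro set_eqI)
    fix p :: "'a \<times> 'a"
    obtain x y where p: "p = (x, y)" by (cases p)
    show "p \<in> ?K \<inter> (\<Inter>x'\<in>closure U. {p \<in> ?K. u (fst p) + c (fst p) (snd p) \<le> u x' + c x' (snd p)})
      \<longleftrightarrow> p \<in> c_subdiff c U V u"
      unfolding p c_subdiff_iff[OF bdd] by auto
  qed
  finally show ?thesis .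
qed

lemma c_subdiff_monotone:
  assumes "\<forall>y\<in>closure V. bdd_above ((\<lambda>x. - c x y - u x) ` closure U)"
    and "(x, y) \<in> c_subdiff c U V u" "(x0, y0) \<in> c_subdiff c U V u"
  shows "c x y + c x0 y0 \<le> c x0 y + c x y0"
proof -
  have "u x + c x y \<le> u x0 + c x0 y" "u x0 + c x0 y0 \<le> u x + c x y0"
    using assms(2,3) unfolding c_subdiff_iff[OF assms(1)] by blast+
  then show ?thesis by linarith
qed

text \<open>A projection of a compact set; in (b) it makes the image of the slab measurable.\<close>

lemma c_subdiff_image_compact:
  assumes "compact (c_subdiff c U V u)" "compact E"
  shows "compact (c_subdiff_image c U V u E)"
proof -
  have "c_subdiff_image c U V u E = snd ` (c_subdiff c U V u \<inter> fst -` E)"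
    unfolding c_subdiff_image_def by force
  moreover have "compact (c_subdiff c U V u \<inter> fst -` E)"
    using assms by (intro compact_Int_closed closed_vimage_fst compact_imp_closed)
  ultimately show ?thesis by (simp add: compact_continuous_image continuous_on_snd)
qed

text \<open>In (a) the cone lies in \<open>X\<close> and its image in the slab, which is too small
  for the lower bound. In (b) the cone lies in \<open>V\<close> and is covered by the image of the
  slab, which is then too large for the upper bound.\<close>

theorem theorem5p1:
  fixes U V :: "'a::euclidean_space set"
    and c :: "'a \<Rightarrow> 'a \<Rightarrow> real"
    and u :: "'a \<Rightarrow> real"
    and lam Lam :: real
  assumes "open U" "bounded U" "open V" "bounded V"
    and "Ck_on_set 4 (closure U \<times> closure V) (\<lambda>(x, y). c x y)"
    and "B1 c U V"
    and "c_convex c U V u"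
    and "lam > 0" "Lam > 0"
  shows "(\<forall>X. X \<subseteq> closure U \<longrightarrow> csub_ge c U V u lam X \<longrightarrow> strongly_cstar_convex c V X \<longrightarrow>
            (X \<times> frontier V) \<inter> c_subdiff c U V u \<subseteq> frontier X \<times> frontier V)
       \<and> (csub_le c U V u Lam (closure U) \<longrightarrow> strongly_c_convex c U V \<longrightarrow>
            (frontier U \<times> V) \<inter> c_subdiff c U V u = {})"
proof -
  obtain N where N: "open N" "closure U \<times> closure V \<subseteq> N" "Ck_on 4 N (case_prod c)"
    using assms(5) unfolding Ck_on_set_def by auto
  have c3: "Ck_on 3 N (case_prod c)" using N(3) by (rule Ck_on_le) simp
  have K: "compact (closure U)" "compact (closure V)" using assms(2,4) by simp_all
  have bdd: "\<forall>y\<in>closure V. bdd_above ((\<lambda>x. - c x y - u x) ` closure U)"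
    using assms(7) unfolding c_convex_def by (rule conjunct1)
  have cont_c: "continuous_on (closure U \<times> closure V) (case_prod c)"
    using Ck_on_3D(1)[OF c3] N(2) by (rule continuous_on_subset)
  show ?thesis
  proof (intro conjI allI impI)
    fix X
    assume X: "X \<subseteq> closure U" and ge: "csub_ge c U V u lam X" and conv: "strongly_cstar_convex c V X"
    show "(X \<times> frontier V) \<inter> c_subdiff c U V u \<subseteq> frontier X \<times> frontier V"
    proof (rule ccontr)
      assume "\<not> ?thesis"
      then obtain x0 y0 where xy: "x0 \<in> X" "y0 \<in> frontier V" "(x0, y0) \<in> c_subdiff c U V u" "x0 \<notin> frontier X"
        by blast
      then have "x0 \<in> interior X" using closure_subset by (auto simp: frontier_def)
      then obtain d where d: "d > 0" "ball x0 d \<subseteq> X" by (meson mem_interior)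
      have "\<exists>E S. open E \<and> E \<subseteq> ball x0 d \<and> compact S \<and> measure lebesgue S < lam * measure lebesgue E \<and>
        (\<forall>x\<in>E. \<forall>y\<in>closure V. c x y + c x0 y0 \<le> c x0 y + c x y0 \<longrightarrow> y \<in> S)"
      proof (rule small_image_of_large_set[OF N(1) _ c3 assms(3,4) xy(2) _ _ assms(8) d(1)])
        show "{x0} \<times> closure V \<subseteq> N" using N(2) xy(1) X by auto
        show "diffeo_onto_range (\<lambda>y. - Dx c x0 y) (closure V)"
          using assms(6) xy(1,2) X unfolding B1_def frontier_def by blast
        show "strongly_convex ((\<lambda>y. - Dx c x0 y) ` V)"
          using conv xy(1) unfolding strongly_cstar_convex_def by blast
      qed
      then obtain E S where E: "open E" "E \<subseteq> ball x0 d" and S: "compact S"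
        "measure lebesgue S < lam * measure lebesgue E"
        "\<And>x y. x \<in> E \<Longrightarrow> y \<in> closure V \<Longrightarrow> c x y + c x0 y0 \<le> c x0 y + c x y0 \<Longrightarrow> y \<in> S"
        by blast
      have sub: "c_subdiff_image c U V u E \<subseteq> S"
      proof
        fix y assume "y \<in> c_subdiff_image c U V u E"
        then obtain x where x: "x \<in> E" "(x, y) \<in> c_subdiff c U V u"
          unfolding c_subdiff_image_def by blast
        then have "y \<in> closure V" by (simp add: c_subdiff_def)
        then show "y \<in> S" by (rule S(3)[OF x(1) _ c_subdiff_monotone[OF bdd x(2) xy(3)]])
      qed
      \<comment> \<open>Where the image is not measurable, \<open>measure\<close> has the default
        value 0 and the bound is trivial.\<close>
      have "measure lebesgue (c_subdiff_image c U V u E) \<le> measure lebesgue S"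
      proof (cases "c_subdiff_image c U V u E \<in> sets lebesgue")
        case True
        then show ?thesis using sub S(1) by (intro measure_mono_fmeasurable lmeasurable_compact)
      qed (simp add: measure_notin_sets)
      moreover have "lam * measure lebesgue E \<le> measure lebesgue (c_subdiff_image c U V u E)"
        using ge[unfolded csub_ge_def, rule_format, of E] E d(2) by simp
      ultimately show False using S(2) by linarith
    qed
  next
    assume le: "csub_le c U V u Lam (closure U)" and conv: "strongly_c_convex c U V"
    show "(frontier U \<times> V) \<inter> c_subdiff c U V u = {}"
    proof (rule ccontr)
      assume "\<not> ?thesis"
      then obtain x0 y0 where xy: "x0 \<in> frontier U" "y0 \<in> V" "(x0, y0) \<in> c_subdiff c U V u" by blast
      have x0: "x0 \<in> closure U" using xy(1) by (simp add: frontier_def)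
      have V: "V \<subseteq> closure V" by (rule closure_subset)
      obtain d where d: "d > 0" "ball y0 d \<subseteq> V" using assms(3) xy(2) open_contains_ball by blast
      \<comment> \<open>With the exchanged cost the cone is built around \<open>y0\<close> in the
        target and the slab around \<open>x0\<close> in the source; the ratio is 1/Lam because the
        slab is now the set being mapped.\<close>
      define c' where "c' = (\<lambda>y x. c x y)"
      have c': "case_prod c' = case_prod c \<circ> prod.swap" by (auto simp: c'_def)
      have D: "Dx c' y x = Dy c x y" for x y by (simp add: Dx_def Dy_def c'_def)
      have "\<exists>E S. open E \<and> E \<subseteq> ball y0 d \<and> compact S \<and> measure lebesgue S < 1 / Lam * measure lebesgue E \<and>
        (\<forall>y\<in>E. \<forall>x\<in>closure U. c' y x + c' y0 x0 \<le> c' y0 x + c' y x0 \<longrightarrow> x \<in> S)"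
      proof (rule small_image_of_large_set[OF _ _ _ assms(1,2) xy(1) _ _ _ d(1)])
        have "prod.swap ` N = prod.swap -` N" by (auto intro: image_eqI[of _ _ "prod.swap _"])
        then show "open (prod.swap ` N)" using N(1) by (simp add: open_vimage continuous_on_swap)
        show "{y0} \<times> closure U \<subseteq> prod.swap ` N" using N(2) xy(2) V by force
        show "Ck_on 3 (prod.swap ` N) (case_prod c')" unfolding c' by (rule Ck_on_swap[OF c3 N(1)])
        show "diffeo_onto_range (\<lambda>x. - Dx c' y0 x) (closure U)"
          using assms(6) x0 xy(2) V unfolding B1_def D by blast
        show "strongly_convex ((\<lambda>x. - Dx c' y0 x) ` U)"
          using conv xy(2) V unfolding strongly_c_convex_def D by blast
        show "1 / Lam > 0" using assms(9) by simp
      qed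
      then obtain E S where E: "open E" "E \<subseteq> ball y0 d" and S: "compact S"
        "measure lebesgue S < 1 / Lam * measure lebesgue E"
        "\<And>y x. y \<in> E \<Longrightarrow> x \<in> closure U \<Longrightarrow> c x y + c x0 y0 \<le> c x y0 + c x0 y \<Longrightarrow> x \<in> S"
        unfolding c'_def by blast
      have cont_u: "continuous_on (closure U) u"
        using xy(2) V by (intro c_convex_continuous_on[OF K _ cont_c assms(7)]) auto
      \<comment> \<open>The slab may leave the closure of \<open>U\<close>, while the upper bound is
        assumed for subsets of that closure only.\<close>
      define S' where "S' = S \<inter> closure U"
      have S': "compact S'" using S(1) by (simp add: S'_def compact_Int_closed)
      have im: "compact (c_subdiff_image c U V u S')"
        by (intro c_subdiff_image_compact compact_c_subdiff K cont_c cont_u bdd S')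
      have "E \<subseteq> c_subdiff_image c U V u S'"
      proof
        fix y assume y: "y \<in> E"
        then have yV: "y \<in> closure V" using E(2) d(2) V by blast
        \<comment> \<open>A minimiser of \<open>u x + c x y\<close> over the compact closure is a
          contact point for \<open>y\<close>, so every point of the cone is reached; monotonicity
          then places that contact point in the slab.\<close>
        have "continuous_on (closure U) (\<lambda>x. u x + case_prod c (x, y))"
          by (intro continuous_intros cont_u continuous_on_compose2[OF cont_c]) (use yV in auto)
        then obtain x where x: "x \<in> closure U" "\<And>x'. x' \<in> closure U \<Longrightarrow> u x + c x y \<le> u x' + c x' y"
          using continuous_attains_inf[OF K(1)] x0 by fastforce
        then have sub: "(x, y) \<in> c_subdiff c U V u" using c_subdiff_iff[OF bdd] yV by blast
        then have "x \<in> S'"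
          unfolding S'_def using S(3)[OF y x(1)] c_subdiff_monotone[OF bdd sub xy(3)] x(1) by simp
        then show "y \<in> c_subdiff_image c U V u S'" using sub unfolding c_subdiff_image_def by blast
      qed
      then have "measure lebesgue E \<le> measure lebesgue (c_subdiff_image c U V u S')"
        using E(1) im by (intro measure_mono_fmeasurable lmeasurable_compact) auto
      also have "\<dots> \<le> Lam * measure lebesgue S'"
        using le S' unfolding csub_le_def S'_def by (simp add: borel_compact)
      also have "\<dots> \<le> Lam * measure lebesgue S"
        using S(1) S' assms(9)
        by (intro mult_left_mono measure_mono_fmeasurable lmeasurable_compact) (auto simp: S'_def borel_compact)
      also have "\<dots> < measure lebesgue E" using S(2) assms(9) by (simp add: field_simps)
      finally show False by simp
    qed
  qed
qed

end
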